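(* Let $n\geq 1$ and let $M$ be a closed $(n+1)$-dimensional affine manifold with developing pair $(\mathrm{dev},\mathrm{hol})$ whose holonomy group $\mathrm{hol}(\pi_1(M))$ leaves invariant an affine line $l\subset\mathbb{A}^{n+1}$. If every element of the holonomy group acts on $l$ by a pure translation, then $\mathrm{dev}(\widetilde M)\cap l=\emptyset$. Equivalently, in coordinates $\mathbb{A}^{n+1}\cong\mathbb{R}\times\mathbb{R}^n$ with $l=\mathbb{R}\times\{0\}$, if the holonomy lies in $$\left\{ x\mapsto \begin{pmatrix} 1 & w\\ 0 & A\end{pmatrix}x+\begin{pmatrix} d\\ 0\end{pmatrix} \;:\; d\in\mathbb{R},\ w^{T}\in\mathbb{R}^n,\ A\in \mathrm{GL}(n,\mathbb{R})\right\},$$ then the developing image does not meet $\mathbb{R}\times\{0\}$.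
   Context: An $m$-dimensional affine manifold is a smooth $m$-manifold $M$ with an atlas of charts into $\mathbb{A}^m$ whose transition maps are, on each connected component of each overlap, restrictions of affine automorphisms. Such a structure determines a developing pair $(\mathrm{dev},\mathrm{hol})$: a local diffeomorphism $\mathrm{dev}:\widetilde M\to\mathbb{A}^m$ on the universal cover and a homomorphism $\mathrm{hol}:\pi_1(M,p)\to\mathrm{Aff}(m,\mathbb{R})$ with $\mathrm{dev}\circ\gamma=\mathrm{hol}(\gamma)\circ\mathrm{dev}$ for every deck transformation $\gamma$. The set $\mathrm{dev}(\widetilde M)$ is the developing image. *)

theory Defs
  imports "HOL-Analysis.Analysis"
begin

definition affine_auto :: "('a::euclidean_space \<Rightarrow> 'a) \<Rightarrow> bool" where
  "affine_auto g \<longleftrightarrow> (\<exists>L b. linear L \<and> bij L \<and> g = (\<lambda>x. L x + b))"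

definition is_chart :: "'m::topological_space set \<Rightarrow> 'm set \<times> ('m \<Rightarrow> 'a::euclidean_space) \<Rightarrow> bool" where
  "is_chart M c \<longleftrightarrow> openin (top_of_set M) (fst c) \<and> open (snd c ` fst c) \<and>
      (\<exists>psi. homeomorphism (fst c) (snd c ` fst c) (snd c) psi)"

definition affine_atlas :: "'m::topological_space set \<Rightarrow> ('m set \<times> ('m \<Rightarrow> 'a::euclidean_space)) set \<Rightarrow> bool" where
  "affine_atlas M A \<longleftrightarrow>
     (\<forall>c\<in>A. is_chart M c) \<and> (\<Union>c\<in>A. fst c) = M \<and>
     (\<forall>c\<in>A. \<forall>d\<in>A. \<forall>K\<in>components (fst c \<inter> fst d).
        \<exists>g. affine_auto g \<and> (\<forall>x\<in>K. snd d x = g (snd c x)))"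

definition universal_cover :: "'c::topological_space set \<Rightarrow> ('c \<Rightarrow> 'm::topological_space) \<Rightarrow> 'm set \<Rightarrow> bool" where
  "universal_cover C p M \<longleftrightarrow> covering_space C p M \<and> path_connected C \<and> simply_connected C"

definition deck_transformation :: "'c::topological_space set \<Rightarrow> ('c \<Rightarrow> 'm) \<Rightarrow> ('c \<Rightarrow> 'c) \<Rightarrow> bool" where
  "deck_transformation C p \<gamma> \<longleftrightarrow> (\<exists>\<delta>. homeomorphism C C \<gamma> \<delta>) \<and> (\<forall>x\<in>C. p (\<gamma> x) = p x)"

definition developing_map ::
  "'c::topological_space set \<Rightarrow> ('c \<Rightarrow> 'm::topological_space) \<Rightarrow> ('m set \<times> ('m \<Rightarrow> 'a::euclidean_space)) set
    \<Rightarrow> ('c \<Rightarrow> 'a) \<Rightarrow> bool" where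
  "developing_map C p A dev \<longleftrightarrow> continuous_on C dev \<and>
     (\<forall>c\<in>A. \<forall>W. W \<subseteq> C \<and> openin (top_of_set C) W \<and> connected W \<and> inj_on p W \<and> p ` W \<subseteq> fst c
        \<longrightarrow> (\<exists>g. affine_auto g \<and> (\<forall>x\<in>W. dev x = g (snd c (p x)))))"

definition developing_pair ::
  "'c::topological_space set \<Rightarrow> ('c \<Rightarrow> 'm::topological_space) \<Rightarrow> ('m set \<times> ('m \<Rightarrow> 'a::euclidean_space)) set
    \<Rightarrow> ('c \<Rightarrow> 'a) \<Rightarrow> (('c \<Rightarrow> 'c) \<Rightarrow> ('a \<Rightarrow> 'a)) \<Rightarrow> bool" where
  "developing_pair C p A dev hol \<longleftrightarrow> developing_map C p A dev \<and>
     (\<forall>\<gamma>. deck_transformation C p \<gamma> \<longrightarrow>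
        affine_auto (hol \<gamma>) \<and> (\<forall>x\<in>C. dev (\<gamma> x) = hol \<gamma> (dev x)))"

end

theory Submission
  imports Defs
begin

text \<open>The holonomy fixes the direction \<open>v\<close> of the line, so by compactness of \<open>M\<close> the flow along \<open>v\<close>
  lifts to a complete flow on the universal cover.  Suppose \<open>dev q0\<close> lies on the line.  Modulo \<open>v\<close> the
  holonomy is linear with origin the line, and compactness of \<open>M\<close> together with the complete flow shows
  that every segment issuing from \<open>dev q0\<close> lifts.  This yields a global section of \<open>dev\<close>, so \<open>dev\<close> is
  injective and onto, and the holonomy group acts freely, properly and cocompactly on the whole affine
  space.  It translates the line, which makes the space fall into two unbounded pieces with bounded
  overlap; in dimension at least two the complement of a ball is connected: contradiction.\<close>

subsection \<open>Lifts through locally injective maps\<close>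

text \<open>The obstacle: \<open>dev\<close> is a priori only a local homeomorphism, and compactness
  of \<open>M\<close> bounds the size of its local sections only up to the maps
  \<open>hol \<gamma>\<close>, which may distort most directions arbitrarily. Two things stay under
  control. Along \<open>v\<close> there is no distortion, so sections exist over full cylinders
  around lines parallel to \<open>v\<close>. Across \<open>v\<close>, a point of the line is an
  origin fixed modulo \<open>v\<close>, so modulo \<open>v\<close> the end of a segment from it is
  the 1/t-dilate of its point at parameter t, and every holonomy map preserves this relation. The
  translation length along the line is uncontrolled; this is why whole cylinders are needed.
  Translations cannot be replaced by scalings of the line: the punctured space modulo x -> 2x is
  compact and its developing image meets every line through the origin. Dimension one is different
  too: the circle R/Z develops onto the line. One continuation principle,
  \<open>radial_lift\<close>, serves path lifting in the covering, the flow along \<open>v\<close>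
  and the lifting of segments.\<close>

text \<open>One notion for three uses: lifts of paths and homotopies through the covering,
  self-lifts of \<open>p\<close> (f = p, giving deck transformations), and sections of
  \<open>dev\<close> (f = identity).\<close>

definition lift_on :: "('x::topological_space \<Rightarrow> 'y) \<Rightarrow> ('c::topological_space \<Rightarrow> 'y) \<Rightarrow> 'c set
    \<Rightarrow> 'x set \<Rightarrow> ('x \<Rightarrow> 'c) \<Rightarrow> bool" where
  "lift_on f p C T s \<longleftrightarrow> continuous_on T s \<and> s ` T \<subseteq> C \<and> (\<forall>x\<in>T. p (s x) = f x)"

text \<open>The property shared by the covering map and \<open>dev\<close> that makes lifts unique;
  \<open>dev\<close> is not known to be a covering.\<close>

definition locally_injective :: "'c::topological_space set \<Rightarrow> ('c \<Rightarrow> 'y) \<Rightarrow> bool" where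
  "locally_injective C p \<longleftrightarrow> (\<forall>x\<in>C. \<exists>U. openin (top_of_set C) U \<and> x \<in> U \<and> inj_on p U)"

lemma lift_on_subset: "lift_on f p C T s \<Longrightarrow> U \<subseteq> T \<Longrightarrow> lift_on f p C U s"
  unfolding lift_on_def by (meson continuous_on_subset image_mono subset_iff order_trans)

lemma lift_on_cong:
  "lift_on f p C T s \<Longrightarrow> (\<And>x. x \<in> T \<Longrightarrow> f x = g x) \<Longrightarrow> lift_on g p C T s"
  unfolding lift_on_def by auto

lemma openin_preimage_lift:
  assumes "continuous_on T s" "s ` T \<subseteq> C" "openin (top_of_set C) U"
  shows "openin (top_of_set T) (T \<inter> s -` U)"
  using assms by (meson continuous_openin_preimage image_subset_iff_funcset)

text \<open>The set where the lifts agree is closed because \<open>C\<close> is Hausdorff and open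
  because \<open>p\<close> is locally injective.\<close>

lemma lift_unique:
  assumes H: "Hausdorff_space (top_of_set C)" and p: "locally_injective C p"
    and T: "connected T" and s1: "lift_on f p C T s1" and s2: "lift_on f p C T s2"
    and a: "a \<in> T" "s1 a = s2 a" and x: "x \<in> T"
  shows "s1 x = s2 x"
proof -
  define E where "E = {x \<in> T. s1 x = s2 x}"
  have c: "continuous_map (top_of_set T) (top_of_set C) s1" "continuous_map (top_of_set T) (top_of_set C) s2"
    using s1 s2 by (auto simp: lift_on_def)
  have cl: "closedin (top_of_set T) E"
    using closedin_continuous_maps_eq[OF H c] by (simp add: E_def)
  have op: "openin (top_of_set T) E"
  proof (subst openin_subopen, intro ballI)
    fix z assume z: "z \<in> E"
    then have "s1 z \<in> C" using s1 by (auto simp: lift_on_def E_def)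
    then obtain U where U: "openin (top_of_set C) U" "s1 z \<in> U" "inj_on p U"
      using p unfolding locally_injective_def by blast
    let ?W = "(T \<inter> s1 -` U) \<inter> (T \<inter> s2 -` U)"
    have "openin (top_of_set T) ?W"
      using s1 s2 U(1) by (intro openin_Int openin_preimage_lift) (auto simp: lift_on_def)
    moreover have "z \<in> ?W" using z U by (auto simp: E_def)
    moreover have "?W \<subseteq> E"
    proof
      fix w assume w: "w \<in> ?W"
      then have "p (s1 w) = p (s2 w)" using s1 s2 by (auto simp: lift_on_def)
      then have "s1 w = s2 w" using w U(3) by (auto simp: inj_on_def)
      then show "w \<in> E" using w by (auto simp: E_def)
    qed
    ultimately show "\<exists>W. openin (top_of_set T) W \<and> z \<in> W \<and> W \<subseteq> E" by blast
  qed
  have "E = {} \<or> E = T" using T cl op connected_clopen by blast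
  then show ?thesis using a x by (auto simp: E_def)
qed

lemma lift_glue:
  assumes op: "\<And>i. i \<in> I \<Longrightarrow> openin (top_of_set K) (U i)"
    and l: "\<And>i. i \<in> I \<Longrightarrow> lift_on f p C (U i) (s i)"
    and agree: "\<And>i j x. i \<in> I \<Longrightarrow> j \<in> I \<Longrightarrow> x \<in> U i \<Longrightarrow> x \<in> U j \<Longrightarrow> s i x = s j x"
  obtains t where "lift_on f p C (\<Union>i\<in>I. U i) t" "\<And>i x. i \<in> I \<Longrightarrow> x \<in> U i \<Longrightarrow> t x = s i x"
proof -
  let ?V = "\<Union>i\<in>I. U i"
  have VK: "?V \<subseteq> K" using op openin_imp_subset by blast
  have o: "openin (top_of_set ?V) (U i)" if "i \<in> I" for i
    using op[OF that] by (rule openin_subset_trans) (use VK that in auto)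
  have c: "continuous_map (subtopology (top_of_set ?V) (U i)) (top_of_set C) (s i)" if i: "i \<in> I" for i
  proof -
    have "?V \<inter> U i = U i" using i by auto
    then show ?thesis
      using l[OF i] unfolding subtopology_subtopology lift_on_def by auto
  qed
  obtain g where g: "continuous_map (top_of_set ?V) (top_of_set C) g"
    and gs: "\<And>x i. \<lbrakk>i \<in> I; x \<in> topspace (top_of_set ?V) \<inter> U i\<rbrakk> \<Longrightarrow> g x = s i x"
  proof (rule pasting_lemma_exists[where X = "top_of_set ?V" and I = I and T = U and Y = "top_of_set C" and f = s])
    show "topspace (top_of_set ?V) \<subseteq> ?V" by simp
    show "s i x = s j x" if "i \<in> I" "j \<in> I" "x \<in> topspace (top_of_set ?V) \<inter> U i \<inter> U j" for i j x
      using agree[of i j x] that by simp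
    show "openin (top_of_set ?V) (U i)" if "i \<in> I" for i by (rule o[OF that])
    show "continuous_map (subtopology (top_of_set ?V) (U i)) (top_of_set C) (s i)" if "i \<in> I" for i
      by (rule c[OF that])
  qed (rule that)
  have gs': "g x = s i x" if "i \<in> I" "x \<in> U i" for i x using gs that by auto
  have "lift_on f p C ?V g"
    using g gs' l unfolding lift_on_def by fastforce
  then show ?thesis using gs' that by blast
qed

text \<open>Continuation in the radius: local lifts around the points of a sphere glue, because two balls
  centred on the sphere that meet also meet inside the ball bounded by it.\<close>

lemma radial_lift:
  fixes K :: "'e::euclidean_space set"
  assumes H: "Hausdorff_space (top_of_set C)" and p: "locally_injective C p"
    and K: "convex K" "closed K" and x0: "x0 \<in> K" and R0: "R0 > 0"
    and base: "lift_on f p C (K \<inter> ball x0 R0) s0"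
    and ext: "\<And>R s e. \<lbrakk>R \<ge> R0; lift_on f p C (K \<inter> ball x0 R) s; s x0 = s0 x0; e \<in> K; dist x0 e = R\<rbrakk>
       \<Longrightarrow> \<exists>N \<tau> x. open N \<and> convex N \<and> e \<in> N \<and> lift_on f p C (K \<inter> N) \<tau> \<and> x \<in> K \<inter> N \<inter> ball x0 R \<and> \<tau> x = s x"
  obtains s where "lift_on f p C K s" "s x0 = s0 x0"
proof -
  define good where "good R \<longleftrightarrow> (\<exists>s. lift_on f p C (K \<inter> ball x0 R) s \<and> s x0 = s0 x0)" for R
  have g0: "good R0" using base by (auto simp: good_def)
  have glue_good: "\<exists>s. lift_on f p C (K \<inter> (\<Union>R\<in>I. ball x0 R)) s \<and> s x0 = s0 x0"
    if I: "I \<subseteq> {R. R \<ge> R0 \<and> good R}" "I \<noteq> {}" for I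
  proof -
    have "\<forall>R\<in>I. \<exists>s. lift_on f p C (K \<inter> ball x0 R) s \<and> s x0 = s0 x0" using I by (auto simp: good_def)
    then obtain S where S: "\<And>R. R \<in> I \<Longrightarrow> lift_on f p C (K \<inter> ball x0 R) (S R)" "\<And>R. R \<in> I \<Longrightarrow> S R x0 = s0 x0"
      by metis
    obtain t where t: "lift_on f p C (\<Union>R\<in>I. K \<inter> ball x0 R) t"
        "\<And>R x. R \<in> I \<Longrightarrow> x \<in> K \<inter> ball x0 R \<Longrightarrow> t x = S R x"
    proof (rule lift_glue[of I K "\<lambda>R. K \<inter> ball x0 R" f p C S])
      fix R R' x assume R: "R \<in> I" "R' \<in> I" "x \<in> K \<inter> ball x0 R" "x \<in> K \<inter> ball x0 R'"
      \<comment> \<open>The smaller of the two truncated balls is convex and contains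
        \<open>x0\<close>, where all these lifts have the same value.\<close>
      let ?T = "K \<inter> ball x0 (min R R')"
      show "S R x = S R' x"
      proof (rule lift_unique[OF H p, of ?T f _ _ x0])
        show "connected ?T" using K by (intro convex_connected convex_Int) auto
        show "lift_on f p C ?T (S R)" "lift_on f p C ?T (S R')"
          by (rule lift_on_subset[OF S(1)[OF R(1)]], auto) (rule lift_on_subset[OF S(1)[OF R(2)]], auto)
        show "x0 \<in> ?T" using R I R0 x0 by (auto dest: subsetD)
        show "x \<in> ?T" using R by auto
        show "S R x0 = S R' x0" using S R by auto
      qed
    qed (use S in \<open>auto simp: openin_open\<close>)
    obtain R where "R \<in> I" using I by auto
    then have "x0 \<in> K \<inter> ball x0 R" using I R0 x0 by (auto dest: subsetD)
    then have "t x0 = s0 x0" using t(2)[OF \<open>R \<in> I\<close>] S(2)[OF \<open>R \<in> I\<close>] by simp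
    moreover have "(\<Union>R\<in>I. K \<inter> ball x0 R) = K \<inter> (\<Union>R\<in>I. ball x0 R)" by auto
    ultimately show ?thesis using t(1) by metis
  qed
  have step: "\<exists>\<delta>>0. good (R + \<delta>)" if R: "R \<ge> R0" and gR: "good R" for R
  proof -
    obtain s where s: "lift_on f p C (K \<inter> ball x0 R) s" "s x0 = s0 x0"
      using gR by (auto simp: good_def)
    let ?S = "K \<inter> sphere x0 R"
    have "\<exists>r \<tau>. r > 0 \<and> lift_on f p C (K \<inter> ball e r) \<tau> \<and> (\<forall>z \<in> K \<inter> ball e r \<inter> ball x0 R. \<tau> z = s z)"
      if e: "e \<in> ?S" for e
    proof -
      obtain N \<tau> x where N: "open N" "convex N" "e \<in> N" "lift_on f p C (K \<inter> N) \<tau>"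
          "x \<in> K \<inter> N \<inter> ball x0 R" "\<tau> x = s x"
        using ext[OF R s, of e] e by auto
      \<comment> \<open>Agreement at the single point \<open>x\<close> spreads over the whole
        overlap, since the overlap is convex.\<close>
      have eq: "\<tau> z = s z" if "z \<in> K \<inter> N \<inter> ball x0 R" for z
      proof (rule lift_unique[OF H p, of "K \<inter> N \<inter> ball x0 R" f _ _ x])
        show "connected (K \<inter> N \<inter> ball x0 R)"
          using K N by (intro convex_connected convex_Int) auto
        show "lift_on f p C (K \<inter> N \<inter> ball x0 R) \<tau>" "lift_on f p C (K \<inter> N \<inter> ball x0 R) s"
          using N s by (auto intro: lift_on_subset)
      qed (use N that in auto)
      obtain r where r: "r > 0" "ball e r \<subseteq> N" using N open_contains_ball by metis
      have "lift_on f p C (K \<inter> ball e r) \<tau>" using N(4) r by (auto intro: lift_on_subset)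
      then show ?thesis using r eq by blast
    qed
    then obtain r \<tau> where r: "\<And>e. e \<in> ?S \<Longrightarrow> r e > 0"
      and \<tau>: "\<And>e. e \<in> ?S \<Longrightarrow> lift_on f p C (K \<inter> ball e (r e)) (\<tau> e)"
      and \<tau>s: "\<And>e z. e \<in> ?S \<Longrightarrow> z \<in> K \<inter> ball e (r e) \<inter> ball x0 R \<Longrightarrow> \<tau> e z = s z"
      by metis
    have \<tau>\<tau>: "\<tau> e z = \<tau> e' z" if e: "e \<in> ?S" "e' \<in> ?S" and z: "z \<in> K \<inter> ball e (r e)" "z \<in> K \<inter> ball e' (r e')" for e e' z
    proof (cases "e = e'")
      case False
      let ?T = "K \<inter> ball e (r e) \<inter> ball e' (r e')"
      \<comment> \<open>The point \<open>w\<close> divides the segment from \<open>e\<close> to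
        \<open>e'\<close> in the ratio of the radii, so it lies in both balls as soon as they meet.
        By strict convexity it is interior to the ball bounded by the sphere, where both local lifts
        equal \<open>s\<close>.\<close>
      define \<theta> where "\<theta> = r e / (r e + r e')"
      have \<theta>: "0 < \<theta>" "\<theta> < 1" "1 - \<theta> = r e' / (r e + r e')" using r[OF e(1)] r[OF e(2)]
        by (auto simp: \<theta>_def field_simps)
      define w where "w = (1 - \<theta>) *\<^sub>R e + \<theta> *\<^sub>R e'"
      have d: "dist e e' < r e + r e'"
        using z by (smt (verit) IntD2 dist_commute dist_triangle mem_ball)
      have "dist e w = \<theta> * dist e e'"
      proof -
        have "e - w = \<theta> *\<^sub>R (e - e')" by (simp add: w_def algebra_simps)
        then show ?thesis using \<theta> by (simp add: dist_norm)
      qed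
      also have "\<dots> < \<theta> * (r e + r e')" using d \<theta> by (intro mult_strict_left_mono) auto
      also have "\<dots> = r e" using r[OF e(1)] r[OF e(2)] by (simp add: \<theta>_def)
      finally have w1: "w \<in> ball e (r e)" by simp
      have "dist e' w = (1 - \<theta>) * dist e e'"
      proof -
        have "e' - w = (1 - \<theta>) *\<^sub>R (e' - e)" by (simp add: w_def algebra_simps)
        then show ?thesis using \<theta>(1,2) by (simp add: dist_norm norm_minus_commute)
      qed
      also have "\<dots> < (1 - \<theta>) * (r e + r e')" using d \<theta>(1,2) by (intro mult_strict_left_mono) auto
      also have "\<dots> = r e'" using r[OF e(1)] r[OF e(2)] by (simp add: \<theta>(3))
      finally have w2: "w \<in> ball e' (r e')" by simp
      have "w \<in> open_segment e e'" unfolding in_segment using \<theta> False by (auto simp: w_def)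
      then have w3: "w \<in> ball x0 R"
        using dist_decreases_open_segment[of w e e' x0] e by auto
      have w4: "w \<in> K" unfolding w_def using e \<theta> by (intro convexD_alt[OF K(1)]) auto
      show ?thesis
      proof (rule lift_unique[OF H p, of ?T f _ _ w])
        show "connected ?T" using K by (intro convex_connected convex_Int) auto
        show "lift_on f p C ?T (\<tau> e)" "lift_on f p C ?T (\<tau> e')"
          using \<tau>[OF e(1)] \<tau>[OF e(2)] by (auto intro: lift_on_subset)
        show "w \<in> ?T" using w1 w2 w4 by auto
        show "\<tau> e w = \<tau> e' w" using \<tau>s[OF e(1), of w] \<tau>s[OF e(2), of w] w1 w2 w3 w4 by auto
        show "z \<in> ?T" using z by auto
      qed
    qed auto
    let ?I = "insert (ball x0 R, s) ((\<lambda>e. (ball e (r e), \<tau> e)) ` ?S)"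
    have I: "i = (ball x0 R, s) \<or> (\<exists>e\<in>?S. i = (ball e (r e), \<tau> e))" if "i \<in> ?I" for i
      using that by blast
    obtain t where t: "lift_on f p C (\<Union>i\<in>?I. K \<inter> fst i) t"
        "\<And>i x. i \<in> ?I \<Longrightarrow> x \<in> K \<inter> fst i \<Longrightarrow> t x = snd i x"
    proof (rule lift_glue[of ?I K "\<lambda>i. K \<inter> fst i" f p C snd])
      fix i j x assume ij: "i \<in> ?I" "j \<in> ?I" and x: "x \<in> K \<inter> fst i" "x \<in> K \<inter> fst j"
      show "snd i x = snd j x"
        using I[OF ij(1)] I[OF ij(2)]
      proof (elim disjE bexE)
        fix e e' assume "e \<in> ?S" "e' \<in> ?S" "i = (ball e (r e), \<tau> e)" "j = (ball e' (r e'), \<tau> e')"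
        then show ?thesis using \<tau>\<tau>[of e e' x] x by simp
      next
        fix e assume "e \<in> ?S" "i = (ball e (r e), \<tau> e)" "j = (ball x0 R, s)"
        then show ?thesis using \<tau>s[of e x] x by simp
      next
        fix e assume "e \<in> ?S" "j = (ball e (r e), \<tau> e)" "i = (ball x0 R, s)"
        then show ?thesis using \<tau>s[of e x] x by simp
      qed simp
    next
      fix i assume "i \<in> ?I"
      from I[OF this] show "openin (top_of_set K) (K \<inter> fst i)" by auto
    next
      fix i assume "i \<in> ?I"
      from I[OF this] show "lift_on f p C (K \<inter> fst i) (snd i)" using s(1) \<tau> by auto
    qed (rule that)
    let ?O = "ball x0 R \<union> (\<Union>e\<in>?S. ball e (r e))"
    have O: "(\<Union>i\<in>?I. K \<inter> fst i) = K \<inter> ?O" by auto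
    \<comment> \<open>A Lebesgue number: by compactness the glued domain contains a uniform
      neighbourhood of the closed truncated ball.\<close>
    obtain \<delta> where \<delta>: "\<delta> > 0" "(\<Union>x\<in>K \<inter> cball x0 R. ball x \<delta>) \<subseteq> ?O"
    proof (rule compact_subset_open_imp_ball_epsilon_subset)
      show "compact (K \<inter> cball x0 R)" using K by (simp add: closed_Int_compact)
      show "open ?O" by auto
      show "K \<inter> cball x0 R \<subseteq> ?O" using r by fastforce
    qed
    have "K \<inter> ball x0 (R + \<delta>) \<subseteq> K \<inter> ?O"
    proof safe
      fix z assume z: "z \<in> K" "z \<in> ball x0 (R + \<delta>)" "z \<notin> (\<Union>e\<in>?S. ball e (r e))"
      show "z \<in> ball x0 R"
      proof (rule ccontr)
        assume "z \<notin> ball x0 R"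
        then have zR: "R \<le> norm (z - x0)" "norm (z - x0) < R + \<delta>"
          using z by (auto simp: dist_norm norm_minus_commute)
        have pos: "norm (z - x0) > 0" using zR R R0 by linarith
        \<comment> \<open>With this scale, \<open>y\<close> is the point where the segment from
          \<open>x0\<close> to \<open>z\<close> crosses the sphere; it lies in \<open>K\<close> by
          convexity and within \<delta> of \<open>z\<close>.\<close>
        define c where "c = R / norm (z - x0)"
        have c: "0 \<le> c" "c \<le> 1" using zR R R0 pos by (auto simp: c_def)
        define y where "y = (1 - c) *\<^sub>R x0 + c *\<^sub>R z"
        have yK: "y \<in> K" unfolding y_def using c z x0 by (intro convexD_alt[OF K(1)]) auto
        have "x0 - y = - c *\<^sub>R (z - x0)" by (simp add: y_def algebra_simps)
        then have "dist x0 y = c * norm (z - x0)" using c by (simp add: dist_norm norm_minus_commute)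
        then have yR: "dist x0 y = R" using pos by (simp add: c_def)
        have "y - z = - ((1 - c) *\<^sub>R (z - x0))" by (simp add: y_def algebra_simps)
        then have "dist y z = (1 - c) * norm (z - x0)" using c by (simp add: dist_norm)
        also have "\<dots> = norm (z - x0) - R" using pos by (simp add: c_def field_simps)
        also have "\<dots> < \<delta>" using zR by simp
        finally have "z \<in> ball y \<delta>" by simp
        then have "z \<in> ?O" using \<delta>(2) yK yR by force
        then show False using z(3) \<open>z \<notin> ball x0 R\<close> by blast
      qed
    qed
    then have "lift_on f p C (K \<inter> ball x0 (R + \<delta>)) t"
      using lift_on_subset[OF t(1)[unfolded O]] by blast
    moreover have "t x0 = s0 x0"
    proof -
      have "x0 \<in> K \<inter> ball x0 R" using x0 R R0 by auto
      then show ?thesis using t(2)[of "(ball x0 R, s)" x0] s(2) by simp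
    qed
    ultimately show ?thesis using \<delta>(1) by (auto simp: good_def)
  qed
  let ?I = "{R. R \<ge> R0 \<and> good R}"
  \<comment> \<open>A finite supremum would itself be good, by gluing over smaller radii, and
    \<open>step\<close> would then pass beyond it.\<close>
  have nb: "\<not> bdd_above ?I"
  proof
    assume b: "bdd_above ?I"
    define R where "R = Sup ?I"
    have RR: "R \<ge> R0" unfolding R_def using b g0 by (intro cSup_upper) auto
    have "(\<Union>R'\<in>?I. ball x0 R') \<supseteq> ball x0 R"
    proof
      fix z assume "z \<in> ball x0 R"
      then have "dist x0 z < Sup ?I" by (simp add: R_def)
      then obtain R' where "R' \<in> ?I" "dist x0 z < R'"
        using less_cSupD[of ?I "dist x0 z"] g0 by auto
      then show "z \<in> (\<Union>R'\<in>?I. ball x0 R')" by auto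
    qed
    moreover obtain s where "lift_on f p C (K \<inter> (\<Union>R\<in>?I. ball x0 R)) s" "s x0 = s0 x0"
      using glue_good[of ?I] g0 by auto
    ultimately have "good R" unfolding good_def
      by (metis (no_types, lifting) Int_mono lift_on_subset order_refl)
    then obtain \<delta> where "\<delta> > 0" "good (R + \<delta>)" using step RR by blast
    then have "R + \<delta> \<le> Sup ?I" using RR b by (intro cSup_upper) auto
    then show False using \<open>\<delta> > 0\<close> by (simp add: R_def)
  qed
  have "(\<Union>R\<in>?I. ball x0 R) = UNIV"
  proof safe
    fix z :: 'e
    obtain R where "R \<in> ?I" "dist x0 z < R" using nb unfolding bdd_above_def by (meson not_le)
    then show "z \<in> (\<Union>R\<in>?I. ball x0 R)" by auto
  qed auto
  then show ?thesis using glue_good[of ?I] g0 that by auto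
qed

subsection \<open>Covering spaces and deck transformations\<close>

lemma lift_on_compose:
  assumes "lift_on f p C T s" "continuous_on U u" "u ` U \<subseteq> T"
  shows "lift_on (f \<circ> u) p C U (s \<circ> u)"
proof -
  have "continuous_on U (s \<circ> u)"
    using assms by (meson continuous_on_compose continuous_on_subset lift_on_def)
  then show ?thesis using assms by (auto simp: lift_on_def image_subset_iff)
qed

lemma covering_locally_injective:
  assumes cov: "covering_space C p M"
  shows "locally_injective C p"
  unfolding locally_injective_def
proof
  fix x assume "x \<in> C"
  then obtain U T q where U: "x \<in> U" "openin (top_of_set C) U" "homeomorphism U T p q"
    using covering_space_local_homeomorphism[OF cov] by metis
  then have "inj_on p U" by (intro inj_on_inverseI[of U q]) (rule homeomorphism_apply1)
  then show "\<exists>U. openin (top_of_set C) U \<and> x \<in> U \<and> inj_on p U" using U by blast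
qed

lemma covering_even_nbhd:
  assumes cov: "covering_space C p M" and "y \<in> M"
  obtains T where "y \<in> T" "openin (top_of_set M) T"
    "\<And>c. c \<in> C \<Longrightarrow> p c \<in> T \<Longrightarrow>
       \<exists>V q. openin (top_of_set C) V \<and> c \<in> V \<and> homeomorphism V T p q"
    "\<And>c d. \<lbrakk>c \<in> C; d \<in> C; p c \<in> T; p d \<in> T; c \<noteq> d; p c = p d\<rbrakk> \<Longrightarrow>
       \<exists>V W. openin (top_of_set C) V \<and> openin (top_of_set C) W \<and> c \<in> V \<and> d \<in> W \<and> disjnt V W"
proof -
  obtain T v where T: "y \<in> T" "openin (top_of_set M) T" "\<Union>v = C \<inter> p -` T"
      "\<forall>u \<in> v. openin (top_of_set C) u" "pairwise disjnt v" "\<forall>u \<in> v. \<exists>q. homeomorphism u T p q"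
    using cov \<open>y \<in> M\<close> unfolding covering_space_def by metis
  have 1: "\<exists>V\<in>v. c \<in> V" if "c \<in> C" "p c \<in> T" for c using T(3) that by auto
  show ?thesis
  proof (rule that[of T])
    fix c assume "c \<in> C" "p c \<in> T"
    then show "\<exists>V q. openin (top_of_set C) V \<and> c \<in> V \<and> homeomorphism V T p q"
      using 1 T by metis
  next
    fix c d assume *: "c \<in> C" "d \<in> C" "p c \<in> T" "p d \<in> T" "c \<noteq> d" "p c = p d"
    then obtain V W where VW: "V \<in> v" "c \<in> V" "W \<in> v" "d \<in> W" using 1 by metis
    moreover have "V \<noteq> W" using T(6) VW * by (metis homeomorphism_apply1)
    ultimately show "\<exists>V W. openin (top_of_set C) V \<and> openin (top_of_set C) W \<and> c \<in> V \<and> d \<in> W \<and> disjnt V W"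
      using T(4,5) by (metis pairwiseD)
  qed (rule T(1) T(2))+
qed

lemma covering_compose:
  assumes cov: "covering_space C p M" and g: "continuous_on T g" "g ` T \<subseteq> C"
  shows "continuous_on T (p \<circ> g)" "(p \<circ> g) ` T \<subseteq> M"
  using continuous_on_compose[OF g(1) continuous_on_subset[OF covering_space_imp_continuous[OF cov] g(2)]]
    g covering_space_imp_surjective[OF cov] by auto

text \<open>Points of different fibres are separated by preimages from \<open>M\<close>, points of
  one fibre by disjoint sheets.\<close>

lemma covering_Hausdorff:
  assumes cov: "covering_space C p M" and H: "Hausdorff_space (top_of_set M)"
  shows "Hausdorff_space (top_of_set C)"
  unfolding Hausdorff_space_def
proof (intro allI impI, elim conjE)
  fix c d assume *: "c \<in> topspace (top_of_set C)" "d \<in> topspace (top_of_set C)" "c \<noteq> d"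
  then have cd: "c \<in> C" "d \<in> C" by auto
  have pM: "p c \<in> M" "p d \<in> M" using cd covering_space_imp_surjective[OF cov] by auto
  show "\<exists>U V. openin (top_of_set C) U \<and> openin (top_of_set C) V \<and> c \<in> U \<and> d \<in> V \<and> disjnt U V"
  proof (cases "p c = p d")
    case True
    obtain T where T: "p c \<in> T" "\<And>c d. \<lbrakk>c \<in> C; d \<in> C; p c \<in> T; p d \<in> T; c \<noteq> d; p c = p d\<rbrakk> \<Longrightarrow>
       \<exists>V W. openin (top_of_set C) V \<and> openin (top_of_set C) W \<and> c \<in> V \<and> d \<in> W \<and> disjnt V W"
      using covering_even_nbhd[OF cov pM(1)] by metis
    show ?thesis using T(2)[OF cd] T(1) True * by simp
  next
    case False
    then obtain U V where UV: "openin (top_of_set M) U" "openin (top_of_set M) V" "p c \<in> U" "p d \<in> V" "disjnt U V"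
      using H pM unfolding Hausdorff_space_def by (metis topspace_euclidean_subtopology)
    have "openin (top_of_set C) (C \<inter> p -` X)" if "openin (top_of_set M) X" for X
      using cov that by (intro openin_preimage_lift) (auto simp: covering_space_def)
    then show ?thesis using UV cd
      by (intro exI[of _ "C \<inter> p -` U"] exI[of _ "C \<inter> p -` V"]) (auto simp: disjnt_iff)
  qed
qed

lemma covering_open_map:
  assumes cov: "covering_space C p M" and W: "openin (top_of_set C) W"
  shows "openin (top_of_set M) (p ` W)"
proof (subst openin_subopen, intro ballI)
  fix y assume "y \<in> p ` W"
  then obtain w where w: "w \<in> W" "y = p w" by auto
  have "w \<in> C" using W w openin_imp_subset by blast
  then obtain V T q where V: "w \<in> V" "openin (top_of_set C) V" "p w \<in> T" "openin (top_of_set M) T" "homeomorphism V T p q"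
    using covering_space_local_homeomorphism[OF cov] by metis
  have "V \<subseteq> C" using V openin_imp_subset by blast
  then have "openin (top_of_set V) (W \<inter> V)"
    using W V by (intro openin_subset_trans[OF openin_Int[OF W V(2)]]) auto
  then have "openin (top_of_set T) (p ` (W \<inter> V))"
    using V(5) homeomorphism_imp_open_map by blast
  then have "openin (top_of_set M) (p ` (W \<inter> V))" using V(4) openin_trans by blast
  then show "\<exists>X. openin (top_of_set M) X \<and> y \<in> X \<and> X \<subseteq> p ` W" using w V by blast
qed

text \<open>The ball is chosen to map into an evenly covered set, and the inverse of the sheet
  through \<open>c\<close> does the lifting. The radius serves all \<open>x\<close> and
  \<open>c\<close>: in a continuation \<open>x\<close> is chosen after the radius, and only then is
  the sheet known.\<close>

lemma covering_even_lift:
  fixes K :: "'e::metric_space set"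
  assumes cov: "covering_space C p M" and f: "continuous_on K f" "f ` K \<subseteq> M" and e: "e \<in> K"
  obtains r where "r > 0" "\<And>x c. \<lbrakk>x \<in> K \<inter> ball e r; c \<in> C; p c = f x\<rbrakk> \<Longrightarrow>
     \<exists>\<tau>. lift_on f p C (K \<inter> ball e r) \<tau> \<and> \<tau> x = c"
proof -
  obtain T where T: "f e \<in> T" "openin (top_of_set M) T"
    "\<And>c. c \<in> C \<Longrightarrow> p c \<in> T \<Longrightarrow>
       \<exists>V q. openin (top_of_set C) V \<and> c \<in> V \<and> homeomorphism V T p q"
    using covering_even_nbhd[OF cov, of "f e"] e f by (metis image_subset_iff)
  have "openin (top_of_set K) (K \<inter> f -` T)" using f T(2) by (rule openin_preimage_lift)
  then obtain r where r: "r > 0" "ball e r \<inter> K \<subseteq> K \<inter> f -` T"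
    unfolding openin_contains_ball using e T(1) by blast
  show ?thesis
  proof (rule that[OF r(1)])
    fix x c assume x: "x \<in> K \<inter> ball e r" "c \<in> C" "p c = f x"
    then have "p c \<in> T" using r by auto
    then obtain V q where V: "openin (top_of_set C) V" "c \<in> V" "homeomorphism V T p q"
      using T(3) x by metis
    have "V \<subseteq> C" using V openin_imp_subset by blast
    have fT: "f ` (K \<inter> ball e r) \<subseteq> T" using r by auto
    have cq: "continuous_on T q" "q ` T = V" "\<And>y. y \<in> T \<Longrightarrow> p (q y) = y" "q (p c) = c"
      using V by (auto simp: homeomorphism_def)
    have "continuous_on (K \<inter> ball e r) (q \<circ> f)"
      using f fT cq by (intro continuous_on_compose) (auto intro: continuous_on_subset)
    then have "lift_on f p C (K \<inter> ball e r) (q \<circ> f)"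
      unfolding lift_on_def using fT cq \<open>V \<subseteq> C\<close> by (auto simp: image_subset_iff)
    moreover have "(q \<circ> f) x = c" using x cq by simp
    ultimately show "\<exists>\<tau>. lift_on f p C (K \<inter> ball e r) \<tau> \<and> \<tau> x = c" by blast
  qed
qed

text \<open>Used with the unit interval for path lifting and with the unit square for homotopy
  lifting.\<close>

lemma covering_lift_convex:
  fixes K :: "'e::euclidean_space set"
  assumes cov: "covering_space C p M" and H: "Hausdorff_space (top_of_set M)"
    and K: "convex K" "closed K" and x0: "x0 \<in> K"
    and f: "continuous_on K f" "f ` K \<subseteq> M" and c: "c \<in> C" "p c = f x0"
  obtains s where "lift_on f p C K s" "s x0 = c"
proof -
  obtain R0 where R0: "R0 > 0" "\<And>x c. \<lbrakk>x \<in> K \<inter> ball x0 R0; c \<in> C; p c = f x\<rbrakk> \<Longrightarrow>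
     \<exists>\<tau>. lift_on f p C (K \<inter> ball x0 R0) \<tau> \<and> \<tau> x = c"
    using covering_even_lift[OF cov f x0] by metis
  obtain s0 where s0: "lift_on f p C (K \<inter> ball x0 R0) s0" "s0 x0 = c"
    using R0(2)[of x0 c] c x0 R0(1) by auto
  obtain s where "lift_on f p C K s" "s x0 = s0 x0"
  proof (rule radial_lift[OF covering_Hausdorff[OF cov H] covering_locally_injective[OF cov] K x0 R0(1) s0(1)])
    fix R s e assume R: "R \<ge> R0" and s: "lift_on f p C (K \<inter> ball x0 R) s" and e: "e \<in> K" "dist x0 e = R"
    obtain r where r: "r > 0" "\<And>x c. \<lbrakk>x \<in> K \<inter> ball e r; c \<in> C; p c = f x\<rbrakk> \<Longrightarrow>
       \<exists>\<tau>. lift_on f p C (K \<inter> ball e r) \<tau> \<and> \<tau> x = c"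
      using covering_even_lift[OF cov f e(1)] by metis
    have Rp: "R > 0" using R R0 by simp
    \<comment> \<open>Moving \<open>e\<close> towards \<open>x0\<close> by the distance \<theta> R <
      r keeps \<open>x\<close> in the even ball and puts it strictly inside the ball of radius
      R.\<close>
    define \<theta> where "\<theta> = min 1 (r / (2 * R))"
    have \<theta>: "0 < \<theta>" "\<theta> \<le> 1" "\<theta> * R < r" using r Rp by (auto simp: \<theta>_def min_def field_simps)
    define x where "x = (1 - \<theta>) *\<^sub>R e + \<theta> *\<^sub>R x0"
    have xK: "x \<in> K" unfolding x_def using e x0 \<theta> by (intro convexD_alt[OF K(1)]) auto
    have "e - x = \<theta> *\<^sub>R (e - x0)" by (simp add: x_def algebra_simps)
    then have d1: "dist e x = \<theta> * R" using e \<theta> by (simp add: dist_norm norm_minus_commute)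
    have "x0 - x = (1 - \<theta>) *\<^sub>R (x0 - e)" by (simp add: x_def algebra_simps)
    then have "dist x0 x = (1 - \<theta>) * R" using e \<theta> by (simp add: dist_norm)
    also have "\<dots> < R" using \<theta> Rp by (simp add: algebra_simps)
    finally have d2: "x \<in> K \<inter> ball x0 R" using xK by simp
    have "s x \<in> C" "p (s x) = f x" using s d2 by (auto simp: lift_on_def)
    then obtain \<tau> where "lift_on f p C (K \<inter> ball e r) \<tau>" "\<tau> x = s x"
      using r(2)[of x "s x"] xK d1 \<theta> by auto
    then show "\<exists>N \<tau> x. open N \<and> convex N \<and> e \<in> N \<and> lift_on f p C (K \<inter> N) \<tau> \<and> x \<in> K \<inter> N \<inter> ball x0 R \<and> \<tau> x = s x"
      using r(1) d1 d2 \<theta> by (intro exI[of _ "ball e r"] exI[of _ \<tau>] exI[of _ x]) auto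
  qed
  then show ?thesis using that s0(2) by simp
qed

lemma covering_lift_path:
  assumes cov: "covering_space C p M" and H: "Hausdorff_space (top_of_set M)"
    and g: "path g" "path_image g \<subseteq> C" and c: "c \<in> C" "p c = p (g 0)"
  obtains s where "lift_on (p \<circ> g) p C {0..1} s" "s 0 = c"
proof (rule covering_lift_convex[OF cov H])
  show "continuous_on {0..1} (p \<circ> g)" "(p \<circ> g) ` {0..1} \<subseteq> M"
    using covering_compose[OF cov g[unfolded path_def path_image_def]] .
  show "p c = (p \<circ> g) 0" using c by simp
  show "convex {0..1::real}" "closed {0..1::real}" "(0::real) \<in> {0..1}" by auto
  show "c \<in> C" by (rule c)
qed (rule that)

text \<open>In the lift of a free homotopy from \<open>r\<close> to a constant loop, the traces of the two ends of the loop
  lift the same path and agree at the constant end, hence everywhere.\<close>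

lemma covering_lift_loop:
  fixes r :: "real \<Rightarrow> 'c::topological_space"
  assumes cov: "covering_space C p M" and H: "Hausdorff_space (top_of_set M)"
    and sc: "simply_connected C"
    and r: "path r" "path_image r \<subseteq> C" "pathfinish r = pathstart r"
    and l: "lift_on (p \<circ> r) p C {0..1} r'"
  shows "r' 1 = r' 0"
proof -
  note uniq = lift_unique[OF covering_Hausdorff[OF cov H] covering_locally_injective[OF cov]]
  have pC: "continuous_on C p" "p ` C = M" using cov by (auto simp: covering_space_def)
  define a where "a = r 0"
  have "a \<in> C" using r by (auto simp: a_def path_image_def)
  have "homotopic_loops C r (\<lambda>_. a)"
    using sc[unfolded simply_connected_def, rule_format, of r "\<lambda>_. a"] r \<open>a \<in> C\<close>
    by (simp add: path_def pathfinish_def pathstart_def path_image_def image_subset_iff)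
  then obtain h where h0: "continuous_on ({0..1::real} \<times> {0..1::real}) h" "h \<in> {0..1} \<times> {0..1} \<rightarrow> C"
      "\<forall>t\<in>{0..1}. h (0, t) = r t" "\<forall>t\<in>{0..1}. h (1, t) = a"
      "\<forall>s\<in>{0..1}. pathfinish (h \<circ> Pair s) = pathstart (h \<circ> Pair s)"
    unfolding homotopic_loops by blast
  have h: "continuous_on ({0..1::real} \<times> {0..1::real}) h" "h ` ({0..1} \<times> {0..1}) \<subseteq> C"
      "\<And>t. t \<in> {0..1} \<Longrightarrow> h (0, t) = r t" "\<And>t. t \<in> {0..1} \<Longrightarrow> h (1, t) = a"
      "\<And>s. s \<in> {0..1} \<Longrightarrow> h (s, 1) = h (s, 0)"
    using h0 by (auto simp: pathstart_def pathfinish_def)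
  let ?K = "{0..1::real} \<times> {0..1::real}"
  have r'0: "r' 0 \<in> C" "p (r' 0) = p (r 0)" using l by (auto simp: lift_on_def)
  obtain \<Lambda> where \<Lambda>: "lift_on (p \<circ> h) p C ?K \<Lambda>" "\<Lambda> (0,0) = r' 0"
  proof (rule covering_lift_convex[OF cov H, of ?K "(0,0)" "p \<circ> h" "r' 0"])
    show "continuous_on ?K (p \<circ> h)" "(p \<circ> h) ` ?K \<subseteq> M" using covering_compose[OF cov h(1,2)] .
    show "p (r' 0) = (p \<circ> h) (0, 0)" using r'0 h(3)[of 0] by simp
    show "convex ?K" "closed ?K" by (auto intro: convex_Times closed_Times)
    show "(0,0) \<in> ?K" by simp
    show "r' 0 \<in> C" by (rule r'0)
  qed (rule that)
  have \<Lambda>c: "continuous_on ?K \<Lambda>" "\<Lambda> ` ?K \<subseteq> C" "\<And>z. z \<in> ?K \<Longrightarrow> p (\<Lambda> z) = p (h z)"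
    using \<Lambda>(1) by (auto simp: lift_on_def)
  have comp: "lift_on (p \<circ> h \<circ> u) p C {0..1} (\<Lambda> \<circ> u)"
    if "continuous_on {0..1} u" "u ` {0..1} \<subseteq> ?K" for u :: "real \<Rightarrow> real \<times> real"
    using lift_on_compose[OF \<Lambda>(1) that] .
  have right: "\<Lambda> (1, 1) = \<Lambda> (1, 0)"
  proof -
    have "(\<Lambda> \<circ> Pair 1) 1 = (\<lambda>_. \<Lambda> (1,0)) (1::real)"
    proof (rule uniq[of "{0..1::real}" "\<lambda>_. p a" "\<Lambda> \<circ> Pair 1" "\<lambda>_. \<Lambda> (1,0)" 0 1])
      show "lift_on (\<lambda>_. p a) p C {0..1} (\<Lambda> \<circ> Pair 1)"
        by (rule lift_on_cong[OF comp[of "Pair 1"]]) (auto intro!: continuous_intros simp: h(4))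
      show "lift_on (\<lambda>_. p a) p C {0..1} (\<lambda>_. \<Lambda> (1,0))"
        using \<Lambda>c h(4)[of 0] by (auto simp: lift_on_def)
    qed auto
    then show ?thesis by simp
  qed
  have "(\<Lambda> \<circ> (\<lambda>s. (s,0))) 0 = (\<Lambda> \<circ> (\<lambda>s. (s,1))) 0"
  proof (rule uniq[of "{0..1::real}" "p \<circ> h \<circ> (\<lambda>s. (s,0))" "\<Lambda> \<circ> (\<lambda>s. (s,0))" "\<Lambda> \<circ> (\<lambda>s. (s,1))" 1 0])
    show "lift_on (p \<circ> h \<circ> (\<lambda>s. (s, 0))) p C {0..1} (\<Lambda> \<circ> (\<lambda>s. (s, 0)))"
      by (rule comp) (auto intro!: continuous_intros)
    show "lift_on (p \<circ> h \<circ> (\<lambda>s. (s, 0))) p C {0..1} (\<Lambda> \<circ> (\<lambda>s. (s, 1)))"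
      by (rule lift_on_cong[OF comp[of "\<lambda>s. (s,1)"]]) (auto intro!: continuous_intros simp: h(5))
  qed (simp_all add: right)
  then have e: "\<Lambda> (0, 1) = \<Lambda> (0, 0)" by simp
  have "(\<Lambda> \<circ> Pair 0) 1 = r' 1"
  proof (rule uniq[of "{0..1::real}" "p \<circ> r" "\<Lambda> \<circ> Pair 0" r' 0 1])
    show "lift_on (p \<circ> r) p C {0..1} (\<Lambda> \<circ> Pair 0)"
      by (rule lift_on_cong[OF comp[of "Pair 0"]]) (auto intro!: continuous_intros simp: h(3))
    show "lift_on (p \<circ> r) p C {0..1} r'" by (rule l)
  qed (simp_all add: \<Lambda>(2))
  then show ?thesis using e \<Lambda>(2) by simp
qed

text \<open>Run along \<open>g\<close> and back along \<open>h\<close>: this loop lifts to a loop,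
  whose first half is the lift \<open>g'\<close> and whose reversed second half is
  \<open>h'\<close>. Both end at its midpoint.\<close>

lemma covering_lift_same_end:
  fixes g h :: "real \<Rightarrow> 'c::topological_space"
  assumes cov: "covering_space C p M" and H: "Hausdorff_space (top_of_set M)"
    and sc: "simply_connected C"
    and g: "path g" "path_image g \<subseteq> C" and h: "path h" "path_image h \<subseteq> C"
    and gh: "pathstart g = pathstart h" "pathfinish g = pathfinish h"
    and g': "lift_on (p \<circ> g) p C {0..1} g'" and h': "lift_on (p \<circ> h) p C {0..1} h'"
    and gh': "g' 0 = h' 0"
  shows "g' 1 = h' 1"
proof -
  note uniq = lift_unique[OF covering_Hausdorff[OF cov H] covering_locally_injective[OF cov]]
  have pC: "continuous_on C p" "p ` C = M" using cov by (auto simp: covering_space_def)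
  define r where "r = g +++ reversepath h"
  have r: "path r" "path_image r \<subseteq> C" "pathfinish r = pathstart r"
    using g h gh by (auto simp: r_def subset_path_image_join)
  have r0: "r 0 = g 0" by (simp add: r_def joinpaths_def)
  obtain r' where r': "lift_on (p \<circ> r) p C {0..1} r'" "r' 0 = g' 0"
  proof (rule covering_lift_path[OF cov H r(1,2)])
    show "g' 0 \<in> C" "p (g' 0) = p (r 0)" using g' r0 by (auto simp: lift_on_def)
  qed (rule that)
  have r1: "r' 1 = r' 0" by (rule covering_lift_loop[OF cov H sc r r'(1)])
  have "(r' \<circ> (\<lambda>t. t / 2)) 1 = g' 1"
  proof (rule uniq[of "{0..1::real}" "p \<circ> g" "r' \<circ> (\<lambda>t. t / 2)" g' 0 1])
    show "lift_on (p \<circ> g) p C {0..1} (r' \<circ> (\<lambda>t. t / 2))"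
      by (rule lift_on_cong[OF lift_on_compose[OF r'(1)]])
        (auto intro!: continuous_intros simp: r_def joinpaths_def)
    show "lift_on (p \<circ> g) p C {0..1} g'" by (rule g')
  qed (simp_all add: r')
  moreover have "(r' \<circ> (\<lambda>t. 1 - t / 2)) 1 = h' 1"
  proof (rule uniq[of "{0..1::real}" "p \<circ> h" "r' \<circ> (\<lambda>t. 1 - t / 2)" h' 0 1])
    have "(p \<circ> r \<circ> (\<lambda>t. 1 - t / 2)) t = (p \<circ> h) t" if t: "t \<in> {0..1}" for t
    \<comment> \<open>At t = 1 the parameter is 1/2, where the joined path is evaluated on its first
      branch \<open>g\<close>; the common end point of \<open>g\<close> and \<open>h\<close> bridges
      the gap.\<close>
    proof (cases "t = 1")
      case True
      then show ?thesis using gh by (simp add: r_def joinpaths_def pathfinish_def)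
    next
      case False
      then have "\<not> 1 - t / 2 \<le> 1 / 2" using t by auto
      then show ?thesis by (simp add: r_def joinpaths_def reversepath_def)
    qed
    moreover have "lift_on (p \<circ> r \<circ> (\<lambda>t. 1 - t / 2)) p C {0..1} (r' \<circ> (\<lambda>t. 1 - t / 2))"
      by (rule lift_on_compose[OF r'(1)]) (auto intro!: continuous_intros)
    ultimately show "lift_on (p \<circ> h) p C {0..1} (r' \<circ> (\<lambda>t. 1 - t / 2))"
      by (rule lift_on_cong[rotated])
    show "lift_on (p \<circ> h) p C {0..1} h'" by (rule h')
  qed (simp_all add: r' r1 gh')
  ultimately show ?thesis by simp
qed

text \<open>The lifting criterion for \<open>p\<close> against itself: a point \<open>x\<close> goes
  to the end of the lift, started at \<open>q'\<close>, of the projection of any path from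
  \<open>q\<close> to \<open>x\<close>. Simple connectedness makes this well defined, local path
  connectedness makes it continuous.\<close>

lemma universal_cover_lift_self:
  fixes C :: "'c::topological_space set"
  assumes cov: "covering_space C p M" and H: "Hausdorff_space (top_of_set M)"
    and sc: "simply_connected C" and pc: "path_connected C" and lpc: "locally path_connected C"
    and q: "q \<in> C" "q' \<in> C" "p q' = p q"
  obtains \<gamma> where "lift_on p p C C \<gamma>" "\<gamma> q = q'"
proof -
  have pC: "continuous_on C p" "p ` C = M" using cov by (auto simp: covering_space_def)
  define R where "R x y \<longleftrightarrow> (\<exists>g g'. path g \<and> path_image g \<subseteq> C \<and> pathstart g = q \<and> pathfinish g = x \<and>
      lift_on (p \<circ> g) p C {0..1} g' \<and> g' 0 = q' \<and> g' 1 = y)" for x y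
  have Rex: "\<exists>y. R x y" if "x \<in> C" for x
  proof -
    obtain g where g: "path g" "path_image g \<subseteq> C" "pathstart g = q" "pathfinish g = x"
      using pc[unfolded path_connected_def] q(1) \<open>x \<in> C\<close> by blast
    obtain g' where "lift_on (p \<circ> g) p C {0..1} g'" "g' 0 = q'"
    proof (rule covering_lift_path[OF cov H g(1,2) q(2)])
      show "p q' = p (g 0)" using q(3) g(3) by (simp add: pathstart_def)
    qed (rule that)
    then show ?thesis using g unfolding R_def by blast
  qed
  have Runiq: "y = z" if "R x y" "R x z" for x y z
    using that covering_lift_same_end[OF cov H sc] unfolding R_def by metis
  define \<gamma> where "\<gamma> x = (SOME y. R x y)" for x
  have \<gamma>R: "R x (\<gamma> x)" if "x \<in> C" for x unfolding \<gamma>_def using Rex[OF that] by (rule someI_ex)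
  have \<gamma>C: "\<gamma> x \<in> C" "p (\<gamma> x) = p x" if x: "x \<in> C" for x
  proof -
    obtain g g' where g: "pathfinish g = x" "lift_on (p \<circ> g) p C {0..1} g'" "g' 1 = \<gamma> x"
      using \<gamma>R[OF x] unfolding R_def by blast
    have "g' 1 \<in> C" "p (g' 1) = p (g 1)" using g(2) by (auto simp: lift_on_def)
    then show "\<gamma> x \<in> C" "p (\<gamma> x) = p x" using g(1,3) by (simp_all add: pathfinish_def)
  qed
  \<comment> \<open>Near \<open>x\<close> the map \<gamma> is \<open>k \<circ> p\<close>, with
    \<open>k\<close> the inverse of the sheet through \<open>\<gamma> x\<close>; paths to nearby
    points are extended by a short path inside \<open>V\<close>.\<close>
  have loc: "\<exists>U s. openin (top_of_set C) U \<and> x \<in> U \<and> lift_on p p C U s \<and> (\<forall>y\<in>U. s y = \<gamma> y)" if x: "x \<in> C" for x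
  proof -
    obtain W T k where W: "\<gamma> x \<in> W" "openin (top_of_set C) W" "p (\<gamma> x) \<in> T" "openin (top_of_set M) T"
        "homeomorphism W T p k"
      using covering_space_local_homeomorphism[OF cov \<gamma>C(1)[OF x]] by metis
    have WC: "W \<subseteq> C" using W openin_imp_subset by blast
    have k: "continuous_on T k" "k ` T = W" "\<And>y. y \<in> T \<Longrightarrow> p (k y) = y" "k (p x) = \<gamma> x"
      using W \<gamma>C[OF x] by (auto simp: homeomorphism_def)
    have "openin (top_of_set C) (C \<inter> p -` T)" using pC W(4) by (intro openin_preimage_lift) auto
    then obtain U V where UV: "openin (top_of_set C) U" "path_connected V" "x \<in> U" "U \<subseteq> V" "V \<subseteq> C \<inter> p -` T"
      using locallyE[OF lpc] x \<gamma>C[OF x] W(3) by (metis IntI vimageI)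
    have "p ` V \<subseteq> T" using UV(5) by auto
    then have "continuous_on V (k \<circ> p)"
      by (intro continuous_on_compose continuous_on_subset[OF pC(1)] continuous_on_subset[OF k(1)]) (use UV in auto)
    then have lV: "lift_on p p C V (k \<circ> p)"
      unfolding lift_on_def using UV(5) k WC by (auto simp: image_subset_iff)
    have "(k \<circ> p) y = \<gamma> y" if y: "y \<in> U" for y
    proof -
      obtain g g' where g: "path g" "path_image g \<subseteq> C" "pathstart g = q" "pathfinish g = x"
        "lift_on (p \<circ> g) p C {0..1} g'" "g' 0 = q'" "g' 1 = \<gamma> x"
        using \<gamma>R[OF x] unfolding R_def by blast
      have "x \<in> V" "y \<in> V" using UV(3,4) y by auto
      then obtain d where d: "path d" "path_image d \<subseteq> V" "pathstart d = x" "pathfinish d = y"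
        using UV(2)[unfolded path_connected_def] by blast
      have dC: "path_image d \<subseteq> C" using d(2) UV(5) by auto
      have ld: "lift_on (p \<circ> d) p C {0..1} (k \<circ> p \<circ> d)"
        using lift_on_compose[OF lV d(1,2)[unfolded path_def path_image_def]] .
      define e e' where "e = g +++ d" and "e' = g' +++ (k \<circ> p \<circ> d)"
      have "path e" "path_image e \<subseteq> C" "pathstart e = q" "pathfinish e = y"
        using g(1-4) d dC unfolding e_def by (simp_all add: subset_path_image_join)
      moreover have "lift_on (p \<circ> e) p C {0..1} e'"
      proof -
        have "path g'" "path (k \<circ> p \<circ> d)" "path_image g' \<subseteq> C" "path_image (k \<circ> p \<circ> d) \<subseteq> C"
          using g(5) ld by (auto simp: lift_on_def path_def path_image_def)
        moreover have "pathfinish g' = pathstart (k \<circ> p \<circ> d)"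
          using g(7) d(3) k(4) by (simp add: pathfinish_def pathstart_def)
        ultimately have "path e'" "path_image e' \<subseteq> C"
          by (auto simp: e'_def subset_path_image_join)
        moreover have "p (e' t) = (p \<circ> e) t" if "t \<in> {0..1}" for t
          using g(5) ld that by (auto simp: lift_on_def e_def e'_def joinpaths_def)
        ultimately show ?thesis by (auto simp: lift_on_def path_def path_image_def)
      qed
      moreover have "e' 0 = q'" "e' 1 = (k \<circ> p) y"
        using g(6) d(4) by (simp_all add: e'_def joinpaths_def pathfinish_def)
      ultimately have "R y ((k \<circ> p) y)" unfolding R_def by blast
      moreover have "y \<in> C" using \<open>y \<in> V\<close> UV(5) by auto
      ultimately show ?thesis using Runiq[OF _ \<gamma>R] by metis
    qed
    then show ?thesis using UV lift_on_subset[OF lV UV(4)] by blast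
  qed
  then obtain U s where Us: "\<And>x. x \<in> C \<Longrightarrow> openin (top_of_set C) (U x)" "\<And>x. x \<in> C \<Longrightarrow> x \<in> U x"
      "\<And>x. x \<in> C \<Longrightarrow> lift_on p p C (U x) (s x)" "\<And>x y. x \<in> C \<Longrightarrow> y \<in> U x \<Longrightarrow> s x y = \<gamma> y"
    by metis
  obtain t where t: "lift_on p p C (\<Union>x\<in>C. U x) t" "\<And>x y. x \<in> C \<Longrightarrow> y \<in> U x \<Longrightarrow> t y = s x y"
  proof (rule lift_glue[of C C U p p C s])
    show "s x z = s y z" if "x \<in> C" "y \<in> C" "z \<in> U x" "z \<in> U y" for x y z
      using Us(4)[of x z] Us(4)[of y z] that by simp
  qed (rule Us that; assumption)+
  have "(\<Union>x\<in>C. U x) = C" using Us openin_imp_subset by blast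
  then have "lift_on p p C C t" using t by simp
  moreover have "t q = q'"
  proof -
    have "t q = \<gamma> q" using t(2)[OF q(1), of q] Us(4)[OF q(1), of q] Us(2)[OF q(1)] by simp
    moreover have "R q q'" unfolding R_def using q
      by (intro exI[of _ "\<lambda>_. q"] exI[of _ "\<lambda>_. q'"])
        (auto simp: path_def path_image_def pathstart_def pathfinish_def lift_on_def)
    ultimately show ?thesis using Runiq \<gamma>R q by metis
  qed
  ultimately show ?thesis using that by blast
qed

text \<open>The self-lifts taking \<open>q\<close> to \<open>q'\<close> and back compose to
  self-lifts with a fixed point, hence to the identity.\<close>

lemma deck_transformation_transitive:
  fixes C :: "'c::topological_space set"
  assumes cov: "covering_space C p M" and H: "Hausdorff_space (top_of_set M)"
    and sc: "simply_connected C" and pc: "path_connected C" and lpc: "locally path_connected C"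
    and q: "q \<in> C" "q' \<in> C" "p q' = p q"
  obtains \<gamma> where "deck_transformation C p \<gamma>" "\<gamma> q = q'"
proof -
  note uniq = lift_unique[OF covering_Hausdorff[OF cov H] covering_locally_injective[OF cov]
      path_connected_imp_connected[OF pc]]
  obtain \<gamma> where \<gamma>: "lift_on p p C C \<gamma>" "\<gamma> q = q'"
    using universal_cover_lift_self[OF cov H sc pc lpc q] by metis
  obtain \<delta> where \<delta>: "lift_on p p C C \<delta>" "\<delta> q' = q"
    using universal_cover_lift_self[OF cov H sc pc lpc q(2,1) q(3)[symmetric]] by metis
  have id: "lift_on p p C C (\<lambda>x. x)" by (auto simp: lift_on_def)
  have comp: "lift_on p p C C (s \<circ> t)" if "lift_on p p C C s" "lift_on p p C C t" for s t
    using lift_on_compose[OF that(1), of C t] that by (auto simp: lift_on_def)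
  have 1: "\<delta> (\<gamma> x) = x" if "x \<in> C" for x
    using uniq[OF comp[OF \<delta>(1) \<gamma>(1)] id q(1) _ that] \<gamma> \<delta> by simp
  have 2: "\<gamma> (\<delta> x) = x" if "x \<in> C" for x
    using uniq[OF comp[OF \<gamma>(1) \<delta>(1)] id q(2) _ that] \<gamma> \<delta> by simp
  have "homeomorphism C C \<gamma> \<delta>"
    using \<gamma>(1) \<delta>(1) 1 2 unfolding lift_on_def by (intro homeomorphismI) auto
  then have "deck_transformation C p \<gamma>"
    using \<gamma>(1) unfolding deck_transformation_def lift_on_def by blast
  then show ?thesis using \<gamma> that by blast
qed

subsection \<open>Local sections of the developing map\<close>

lemma affine_auto_inverse:
  assumes "affine_auto g"
  obtains g' where "affine_auto g'" "\<And>x. g (g' x) = x" "\<And>x. g' (g x) = x"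
proof -
  obtain L b where L: "linear L" "bij L" "g = (\<lambda>x. L x + b)" using assms by (auto simp: affine_auto_def)
  define L' where "L' = inv L"
  have LL: "L (L' x) = x" "L' (L x) = x" for x
    using L(2) by (auto simp: L'_def bij_def surj_f_inv_f)
  have lin: "linear L'"
  proof (rule linearI)
    show "L' (x + y) = L' x + L' y" for x y
      using LL linear_add[OF L(1), of "L' x" "L' y"] by metis
    show "L' (c *\<^sub>R x) = c *\<^sub>R L' x" for c x
      using LL linear_scale[OF L(1), of c "L' x"] by metis
  qed
  show ?thesis
  proof (rule that[of "\<lambda>x. L' x + - L' b"])
    show "affine_auto (\<lambda>x. L' x + - L' b)"
      unfolding affine_auto_def using lin bij_imp_bij_inv[OF L(2)] L'_def by blast
    show "g (L' x + - L' b) = x" "L' (g x) + - L' b = x" for x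
      using LL by (simp_all add: L(3) linear_add[OF L(1)] linear_add[OF lin] linear_diff[OF L(1)])
  qed
qed

lemma affine_auto_continuous:
  assumes "affine_auto g"
  shows "continuous_on S g"
proof -
  obtain L b where "linear L" "g = (\<lambda>x. L x + b)" using assms by (auto simp: affine_auto_def)
  then show ?thesis
    by (simp add: continuous_on_add linear_continuous_on linear_conv_bounded_linear)
qed

lemma affine_auto_open_image:
  assumes g: "affine_auto g" and "open B"
  shows "open (g ` B)"
proof -
  obtain g' where g': "affine_auto g'" "\<And>x. g (g' x) = x" "\<And>x. g' (g x) = x"
    using affine_auto_inverse[OF g] by blast
  have "g ` B = g' -` B"
  proof (intro set_eqI iffI)
    show "x \<in> g ` B" if "x \<in> g' -` B" for x using that g'(2)[of x] by (metis image_eqI vimageE)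
  qed (use g'(3) in auto)
  then show ?thesis using affine_auto_continuous[OF g'(1)] \<open>open B\<close> open_vimage by metis
qed

lemma affine_auto_comb:
  "affine_auto h \<Longrightarrow> h ((1 - u) *\<^sub>R x + u *\<^sub>R y) = (1 - u) *\<^sub>R h x + u *\<^sub>R h y"
  by (auto simp: affine_auto_def linear_add linear_scale linear_diff algebra_simps)

lemma affine_auto_convex_vimage:
  assumes "affine_auto h" "convex Z"
  shows "convex (h -` Z)"
  unfolding convex_alt
  using affine_auto_comb[OF assms(1)] assms(2) by (auto simp: convex_alt)

text \<open>On a small sheet over a chart, \<open>dev\<close> is an affine automorphism after the
  chart after \<open>p\<close>; the section inverts the three factors. Openness of the images of
  \<tau> later yields neighbourhoods in \<open>M\<close>, and injectivity of \<open>p\<close> on the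
  image yields properness of the holonomy action.\<close>

lemma developing_map_local_section:
  fixes dev :: "'c::topological_space \<Rightarrow> 'a::euclidean_space"
  assumes A: "affine_atlas M A" and cov: "covering_space C p M" and dm: "developing_map C p A dev"
    and q: "q \<in> C"
  obtains r \<tau> where "r > 0" "lift_on (\<lambda>x. x) dev C (ball (dev q) r) \<tau>" "\<tau> (dev q) = q"
    "\<And>U. open U \<Longrightarrow> U \<subseteq> ball (dev q) r \<Longrightarrow> openin (top_of_set C) (\<tau> ` U)"
    "inj_on p (\<tau> ` ball (dev q) r)"
proof -
  have pC: "continuous_on C p" "p ` C = M" using cov by (auto simp: covering_space_def)
  have "p q \<in> (\<Union>c\<in>A. fst c)" using A pC q by (auto simp: affine_atlas_def)
  then obtain c where c: "c \<in> A" "p q \<in> fst c" by blast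
  define S \<phi> where "S = fst c" and "\<phi> = snd c"
  obtain \<psi> where S: "openin (top_of_set M) S" "open (\<phi> ` S)" "homeomorphism S (\<phi> ` S) \<phi> \<psi>"
    using A c by (auto simp: affine_atlas_def is_chart_def S_def \<phi>_def)
  obtain V T k where V: "q \<in> V" "openin (top_of_set C) V" "p q \<in> T" "openin (top_of_set M) T" "homeomorphism V T p k"
    using covering_space_local_homeomorphism[OF cov q] by metis
  have VC: "V \<subseteq> C" using V openin_imp_subset by blast
  have SM: "S \<subseteq> M" using S openin_imp_subset by blast
  have "openin (top_of_set S) (S \<inter> T)"
    using openin_Int[OF S(1) V(4)] by (rule openin_subset_trans) (use SM in auto)
  then have "openin (top_of_set (\<phi> ` S)) (\<phi> ` (S \<inter> T))"
    using S(3) homeomorphism_imp_open_map by blast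
  then have "open (\<phi> ` (S \<inter> T))" using S(2) openin_open_eq by blast
  then obtain \<epsilon> where \<epsilon>: "\<epsilon> > 0" "ball (\<phi> (p q)) \<epsilon> \<subseteq> \<phi> ` (S \<inter> T)"
    using c V(3) unfolding open_contains_ball S_def by blast
  \<comment> \<open>A ball in the chart is used so that its image \<open>W\<close> is connected, as
    the defining property of \<open>dev\<close> on sheets demands.\<close>
  define B where "B = ball (\<phi> (p q)) \<epsilon>"
  define \<sigma> where "\<sigma> = k \<circ> \<psi>"
  define W where "W = \<sigma> ` B"
  have \<psi>: "\<psi> b \<in> S" "\<psi> b \<in> T" "\<phi> (\<psi> b) = b" if "b \<in> B" for b
  proof -
    obtain y where "y \<in> S" "y \<in> T" "b = \<phi> y" using \<epsilon>(2) \<open>b \<in> B\<close> by (auto simp: B_def)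
    then show "\<psi> b \<in> S" "\<psi> b \<in> T" "\<phi> (\<psi> b) = b" using homeomorphism_apply1[OF S(3)] by auto
  qed
  have k: "k t \<in> V" "p (k t) = t" if "t \<in> T" for t
    using V(5) that by (auto simp: homeomorphism_def)
  have \<sigma>V: "\<sigma> b \<in> V" "p (\<sigma> b) = \<psi> b" if "b \<in> B" for b
    using k[OF \<psi>(2)[OF that]] by (simp_all add: \<sigma>_def)
  have c\<sigma>: "continuous_on B \<sigma>"
  proof -
    have "B \<subseteq> \<phi> ` S" "\<psi> ` B \<subseteq> T" using \<psi> by force+
    then show ?thesis unfolding \<sigma>_def using S(3) V(5)
      by (intro continuous_on_compose) (auto simp: homeomorphism_def intro: continuous_on_subset)
  qed
  have injW: "inj_on p W"
    unfolding W_def by (rule inj_on_inverseI[of _ k]) (use \<sigma>V(2) in \<open>auto simp: \<sigma>_def\<close>)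
  have opW: "openin (top_of_set C) W"
  proof -
    have "\<psi> ` B = S \<inter> \<phi> -` B"
      using \<psi> homeomorphism_apply1[OF S(3)] by (auto simp: image_iff) metis
    moreover have "openin (top_of_set S) (S \<inter> \<phi> -` B)"
      using S(3) by (intro continuous_openin_preimage_gen) (auto simp: homeomorphism_def B_def)
    ultimately have "openin (top_of_set M) (\<psi> ` B)" using S(1) openin_trans by metis
    then have "openin (top_of_set C) (C \<inter> p -` (\<psi> ` B))" using pC by (intro openin_preimage_lift) auto
    moreover have "W = V \<inter> (C \<inter> p -` (\<psi> ` B))"
    proof
      show "W \<subseteq> V \<inter> (C \<inter> p -` (\<psi> ` B))" using \<sigma>V VC by (auto simp: W_def)
      show "V \<inter> (C \<inter> p -` (\<psi> ` B)) \<subseteq> W"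
      proof
        fix x assume "x \<in> V \<inter> (C \<inter> p -` (\<psi> ` B))"
        then obtain b where b: "x \<in> V" "b \<in> B" "p x = \<psi> b" by auto
        then have "x = \<sigma> b" using homeomorphism_apply1[OF V(5)] by (metis \<sigma>_def comp_apply)
        then show "x \<in> W" using b by (simp add: W_def)
      qed
    qed
    ultimately show ?thesis using V(2) by (metis openin_Int)
  qed
  have conW: "connected W" unfolding W_def using c\<sigma> by (rule connected_continuous_image) (simp add: B_def)
  have "p ` W \<subseteq> fst c" using \<sigma>V \<psi> by (auto simp: W_def S_def)
  then obtain g where g: "affine_auto g" "\<And>x. x \<in> W \<Longrightarrow> dev x = g (\<phi> (p x))"
    using dm c(1) opW conW injW openin_imp_subset[OF opW] unfolding developing_map_def \<phi>_def by meson
  have dev\<sigma>: "dev (\<sigma> b) = g b" if "b \<in> B" for b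
    using g(2)[of "\<sigma> b"] \<sigma>V[OF that] \<psi>[OF that] that by (simp add: W_def)
  obtain g' where g': "affine_auto g'" "\<And>x. g (g' x) = x" "\<And>x. g' (g x) = x"
    using affine_auto_inverse[OF g(1)] by blast
  have pqB: "\<phi> (p q) \<in> B" using \<epsilon> by (simp add: B_def)
  have \<sigma>q: "\<sigma> (\<phi> (p q)) = q"
    using homeomorphism_apply1[OF S(3), of "p q"] homeomorphism_apply1[OF V(5) V(1)] c by (simp add: \<sigma>_def S_def)
  have devq: "dev q = g (\<phi> (p q))" using dev\<sigma>[OF pqB] \<sigma>q by simp
  have "open (g ` B)" using g(1) by (rule affine_auto_open_image) (simp add: B_def)
  then obtain r where r: "r > 0" "ball (dev q) r \<subseteq> g ` B"
    using pqB devq unfolding open_contains_ball by blast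
  define \<tau> where "\<tau> = \<sigma> \<circ> g'"
  have g'B: "g' u \<in> B" if "u \<in> ball (dev q) r" for u using r(2) that g'(3) by force
  have sec: "lift_on (\<lambda>x. x) dev C (ball (dev q) r) \<tau>"
    unfolding lift_on_def
  proof (intro conjI ballI)
    have "g' ` ball (dev q) r \<subseteq> B" using g'B by blast
    then show "continuous_on (ball (dev q) r) \<tau>"
      unfolding \<tau>_def using c\<sigma> affine_auto_continuous[OF g'(1)]
      by (intro continuous_on_compose) (auto intro: continuous_on_subset)
    show "\<tau> ` ball (dev q) r \<subseteq> C" using g'B \<sigma>V VC by (fastforce simp: \<tau>_def)
    show "dev (\<tau> u) = u" if "u \<in> ball (dev q) r" for u
      using dev\<sigma>[OF g'B[OF that]] g'(2) by (simp add: \<tau>_def)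
  qed
  show ?thesis
  proof (rule that[OF r(1) sec])
    show "\<tau> (dev q) = q" using \<sigma>q devq g' by (simp add: \<tau>_def)
    show "inj_on p (\<tau> ` ball (dev q) r)"
      using injW by (rule inj_on_subset) (use g'B in \<open>auto simp: \<tau>_def W_def\<close>)
    fix U assume U: "open U" "U \<subseteq> ball (dev q) r"
    have "\<tau> ` U = W \<inter> (C \<inter> dev -` U)"
    proof
      show "\<tau> ` U \<subseteq> W \<inter> (C \<inter> dev -` U)"
      proof
        fix x assume "x \<in> \<tau> ` U"
        then obtain u where u: "u \<in> U" "x = \<tau> u" by auto
        then have u': "u \<in> ball (dev q) r" using U by auto
        then have "x \<in> C" "dev x = u" using sec u by (auto simp: lift_on_def)
        then show "x \<in> W \<inter> (C \<inter> dev -` U)" using u g'B[OF u'] by (auto simp: \<tau>_def W_def)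
      qed
      show "W \<inter> (C \<inter> dev -` U) \<subseteq> \<tau> ` U"
      proof
        fix x assume "x \<in> W \<inter> (C \<inter> dev -` U)"
        then obtain b where b: "b \<in> B" "x = \<sigma> b" "dev x \<in> U" by (auto simp: W_def)
        then have "g b \<in> U" using dev\<sigma> by simp
        moreover have "x = \<tau> (g b)" using b g' by (simp add: \<tau>_def)
        ultimately show "x \<in> \<tau> ` U" by blast
      qed
    qed
    moreover have "openin (top_of_set C) (C \<inter> dev -` U)"
      using dm U by (intro continuous_openin_preimage_gen) (auto simp: developing_map_def)
    ultimately show "openin (top_of_set C) (\<tau> ` U)" using opW by (metis openin_Int)
  qed
qed

section \<open>Holonomy, deck transformations and sections over an affine manifold\<close>

locale affine_universal_cover =
  fixes M :: "'m::topological_space set"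
    and A :: "('m set \<times> ('m \<Rightarrow> 'a::euclidean_space)) set"
    and C :: "'c::topological_space set"
    and p :: "'c \<Rightarrow> 'm"
    and dev :: "'c \<Rightarrow> 'a"
    and hol :: "('c \<Rightarrow> 'c) \<Rightarrow> ('a \<Rightarrow> 'a)"
    and a v :: 'a
  assumes compact_M: "compact M"
    and Hausdorff_M: "Hausdorff_space (top_of_set M)"
    and atlas: "affine_atlas M A"
    and universal: "universal_cover C p M"
    and pair: "developing_pair C p A dev hol"
    and v_nz: "v \<noteq> 0"
    and translation: "\<And>\<gamma>. deck_transformation C p \<gamma> \<Longrightarrow>
           \<exists>s::real. \<forall>t::real. hol \<gamma> (a + t *\<^sub>R v) = a + (t + s) *\<^sub>R v"
begin

lemma cov: "covering_space C p M" and pcC: "path_connected C" and scC: "simply_connected C"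
  using universal by (auto simp: universal_cover_def)

lemma Hausdorff_C: "Hausdorff_space (top_of_set C)"
  using covering_Hausdorff[OF cov Hausdorff_M] .

lemma dev_map: "developing_map C p A dev"
  using pair by (simp add: developing_pair_def)

lemmas local_section = developing_map_local_section[OF atlas cov dev_map]

abbreviation sec :: "'a set \<Rightarrow> ('a \<Rightarrow> 'c) \<Rightarrow> bool" where
  "sec \<equiv> lift_on (\<lambda>x. x) dev C"

lemma sec_dev: "sec T s \<Longrightarrow> x \<in> T \<Longrightarrow> dev (s x) = x"
  and sec_C: "sec T s \<Longrightarrow> x \<in> T \<Longrightarrow> s x \<in> C"
  by (auto simp: lift_on_def)

lemma dev_locally_injective: "locally_injective C dev"
  unfolding locally_injective_def
proof
  fix q assume "q \<in> C"
  then obtain r \<tau> where r: "r > 0" "sec (ball (dev q) r) \<tau>" "\<tau> (dev q) = q"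
    "\<And>U. open U \<Longrightarrow> U \<subseteq> ball (dev q) r \<Longrightarrow> openin (top_of_set C) (\<tau> ` U)"
    using local_section by metis
  have "inj_on dev (\<tau> ` ball (dev q) r)"
    by (rule inj_on_inverseI[of _ \<tau>]) (use sec_dev[OF r(2)] in auto)
  then show "\<exists>U. openin (top_of_set C) U \<and> q \<in> U \<and> inj_on dev U"
    using r(1,3) r(4)[of "ball (dev q) r"] by (metis centre_in_ball image_eqI open_ball order_refl)
qed

lemmas sec_unique = lift_unique[OF Hausdorff_C dev_locally_injective]

text \<open>Local sections carry small balls onto open path-connected sets. This is what the
  construction of deck transformations requires of \<open>C\<close>.\<close>

lemma locally_path_connected_C: "locally path_connected C"
proof (rule locallyI)
  fix w x assume w: "openin (top_of_set C) w" "x \<in> w"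
  then have "x \<in> C" using openin_imp_subset by blast
  then obtain r \<tau> where r: "r > 0" "sec (ball (dev x) r) \<tau>" "\<tau> (dev x) = x"
    "\<And>U. open U \<Longrightarrow> U \<subseteq> ball (dev x) r \<Longrightarrow> openin (top_of_set C) (\<tau> ` U)"
    using local_section by metis
  have "openin (top_of_set (ball (dev x) r)) (ball (dev x) r \<inter> \<tau> -` w)"
    using r(2) w(1) by (intro openin_preimage_lift) (auto simp: lift_on_def)
  then have "open (ball (dev x) r \<inter> \<tau> -` w)" using openin_open_eq open_ball by blast
  then obtain r' where r': "r' > 0" "ball (dev x) r' \<subseteq> ball (dev x) r \<inter> \<tau> -` w"
    unfolding open_contains_ball using w(2) r(1,3) by (metis IntI centre_in_ball vimageI)
  let ?U = "\<tau> ` ball (dev x) r'"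
  have "path_connected ?U"
    using r(2) r' by (intro path_connected_continuous_image convex_imp_path_connected)
      (auto simp: lift_on_def intro: continuous_on_subset)
  moreover have "openin (top_of_set C) ?U" using r(4)[of "ball (dev x) r'"] r' by auto
  moreover have "x \<in> ?U" using r(3) r'(1) by (metis centre_in_ball image_eqI)
  moreover have "?U \<subseteq> w" using r' by auto
  ultimately show "\<exists>U V. openin (top_of_set C) U \<and> path_connected V \<and> x \<in> U \<and> U \<subseteq> V \<and> V \<subseteq> w"
    by blast
qed

lemma deck_transitive:
  assumes "q \<in> C" "q' \<in> C" "p q' = p q"
  obtains \<gamma> \<delta> where "deck_transformation C p \<gamma>" "homeomorphism C C \<gamma> \<delta>" "\<gamma> q = q'"
proof -
  obtain \<gamma> where "deck_transformation C p \<gamma>" "\<gamma> q = q'"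
    using deck_transformation_transitive[OF cov Hausdorff_M scC pcC locally_path_connected_C assms] by blast
  then show ?thesis using that unfolding deck_transformation_def by blast
qed

lemma hol_affine: "deck_transformation C p \<gamma> \<Longrightarrow> affine_auto (hol \<gamma>)"
  and hol_dev: "deck_transformation C p \<gamma> \<Longrightarrow> x \<in> C \<Longrightarrow> dev (\<gamma> x) = hol \<gamma> (dev x)"
  using pair by (auto simp: developing_pair_def)

text \<open>The hypothesis speaks of the line alone, but \<open>hol \<gamma>\<close> is affine:
  comparing the images of \<open>a\<close> and \<open>a + v\<close> shows that its linear part fixes
  \<open>v\<close>, so it commutes with translations along \<open>v\<close> everywhere.\<close>

lemma hol_translate:
  assumes "deck_transformation C p \<gamma>"
  shows "hol \<gamma> (x + t *\<^sub>R v) = hol \<gamma> x + t *\<^sub>R v"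
proof -
  obtain L b where L: "linear L" "hol \<gamma> = (\<lambda>x. L x + b)"
    using hol_affine[OF assms] by (auto simp: affine_auto_def)
  obtain s where "\<And>t. hol \<gamma> (a + t *\<^sub>R v) = a + (t + s) *\<^sub>R v" using translation[OF assms] by blast
  from this[of 0] this[of 1] have s: "hol \<gamma> a = a + s *\<^sub>R v" "hol \<gamma> (a + v) = a + (1 + s) *\<^sub>R v" by simp_all
  have "L v = hol \<gamma> (a + v) - hol \<gamma> a" by (simp add: L(2) linear_add[OF L(1)])
  also have "\<dots> = v" unfolding s by (simp add: algebra_simps)
  finally have "L v = v" .
  then show ?thesis by (simp add: L(2) linear_add[OF L(1)] linear_scale[OF L(1)])
qed

text \<open>Equivariance moves sections between points of a fibre. The price is that the domain is
  replaced by its preimage under \<open>hol \<gamma>\<close>.\<close>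

lemma hol_sec:
  assumes \<gamma>: "deck_transformation C p \<gamma>" "homeomorphism C C \<gamma> \<delta>" and \<tau>: "sec T \<tau>"
  shows "sec (hol \<gamma> -` T) (\<delta> \<circ> \<tau> \<circ> hol \<gamma>)"
  unfolding lift_on_def
proof (intro conjI ballI)
  have h: "continuous_on (hol \<gamma> -` T) (hol \<gamma>)"
    using affine_auto_continuous[OF hol_affine[OF \<gamma>(1)]] .
  have \<tau>c: "continuous_on T \<tau>" "\<tau> ` T \<subseteq> C" using \<tau> by (auto simp: lift_on_def)
  have \<delta>: "continuous_on C \<delta>" "\<delta> ` C = C" using \<gamma>(2) by (auto simp: homeomorphism_def)
  have "continuous_on T (\<delta> \<circ> \<tau>)"
    using \<tau>c \<delta> by (intro continuous_on_compose) (auto intro: continuous_on_subset)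
  then have "continuous_on (hol \<gamma> ` (hol \<gamma> -` T)) (\<delta> \<circ> \<tau>)"
    by (rule continuous_on_subset) auto
  then show "continuous_on (hol \<gamma> -` T) (\<delta> \<circ> \<tau> \<circ> hol \<gamma>)"
    by (rule continuous_on_compose[OF h])
  show "(\<delta> \<circ> \<tau> \<circ> hol \<gamma>) ` (hol \<gamma> -` T) \<subseteq> C" using \<tau>c \<delta> by auto
  fix u assume u: "u \<in> hol \<gamma> -` T"
  define c where "c = \<delta> (\<tau> (hol \<gamma> u))"
  have c: "c \<in> C" "\<gamma> c = \<tau> (hol \<gamma> u)"
    using u \<tau>c \<delta> homeomorphism_apply2[OF \<gamma>(2)] by (auto simp: c_def)
  have "hol \<gamma> (dev c) = hol \<gamma> u"
    using hol_dev[OF \<gamma>(1) c(1)] c(2) sec_dev[OF \<tau>, of "hol \<gamma> u"] u by simp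
  moreover obtain g' where "\<And>x. g' (hol \<gamma> x) = x"
    using affine_auto_inverse[OF hol_affine[OF \<gamma>(1)]] by metis
  ultimately have "dev c = u" by metis
  then show "dev ((\<delta> \<circ> \<tau> \<circ> hol \<gamma>) u) = u" by (simp add: c_def)
qed

text \<open>Uniformity comes from compactness of \<open>M\<close>: the holonomy fixes the direction \<open>v\<close>, so a section
  around one point of a fibre transports to every other point without shrinking along \<open>v\<close>.\<close>

lemma uniform_sections:
  obtains \<epsilon> where "\<epsilon> > 0"
    "\<And>q. q \<in> C \<Longrightarrow> \<exists>N \<tau>. open N \<and> convex N \<and> (\<forall>t. \<bar>t\<bar> \<le> \<epsilon> \<longrightarrow> dev q + t *\<^sub>R v \<in> N) \<and> sec N \<tau> \<and> \<tau> (dev q) = q"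
proof -
  have "\<forall>q\<in>C. \<exists>r \<tau>. r > 0 \<and> sec (ball (dev q) r) \<tau> \<and> \<tau> (dev q) = q \<and>
    (\<forall>U. open U \<longrightarrow> U \<subseteq> ball (dev q) r \<longrightarrow> openin (top_of_set C) (\<tau> ` U))"
    using local_section by metis
  then obtain r \<tau> where r: "\<And>q. q \<in> C \<Longrightarrow> r q > 0"
    and \<tau>: "\<And>q. q \<in> C \<Longrightarrow> sec (ball (dev q) (r q)) (\<tau> q)" "\<And>q. q \<in> C \<Longrightarrow> \<tau> q (dev q) = q"
    and op: "\<And>q U. q \<in> C \<Longrightarrow> open U \<Longrightarrow> U \<subseteq> ball (dev q) (r q) \<Longrightarrow> openin (top_of_set C) (\<tau> q ` U)"
    by metis
  \<comment> \<open>Half the radius: the other half is the margin for displacements along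
    \<open>v\<close>.\<close>
  define B where "B q = ball (dev q) (r q / 2)" for q
  define V where "V q = p ` \<tau> q ` B q" for q
  have BO: "B q \<subseteq> ball (dev q) (r q)" "dev q \<in> B q" if "q \<in> C" for q
    using r[OF that] by (auto simp: B_def)
  have pM: "p q \<in> M" if "q \<in> C" for q using covering_space_imp_surjective[OF cov] that by blast
  have "\<exists>Q. finite Q \<and> Q \<subseteq> C \<and> M \<subseteq> (\<Union>q\<in>Q. V q)"
  proof -
    have "\<forall>c\<in>V ` C. openin (top_of_set M) c"
      using covering_open_map[OF cov op] BO by (auto simp: V_def B_def)
    moreover have "M \<subseteq> \<Union>(V ` C)"
    proof
      fix m assume "m \<in> M"
      then obtain q where q: "q \<in> C" "m = p q" using covering_space_imp_surjective[OF cov] by blast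
      then have "m \<in> V q" unfolding V_def using BO(2)[OF q(1)] \<tau>(2)[OF q(1)] by (metis image_eqI)
      then show "m \<in> \<Union>(V ` C)" using q by blast
    qed
    ultimately obtain D where "D \<subseteq> V ` C" "finite D" "M \<subseteq> \<Union>D"
      using compact_M unfolding compact_eq_openin_cover by meson
    then show ?thesis using finite_subset_image by metis
  qed
  then obtain Q where Q: "finite Q" "Q \<subseteq> C" "M \<subseteq> (\<Union>q\<in>Q. V q)" by blast
  \<comment> \<open>A displacement of length at most \<epsilon> |v| is at most a quarter of each of
    the finitely many radii, so it does not leave the full ball from \<open>B q\<close>. The
    inserted 1 keeps the minimum defined for empty \<open>Q\<close>.\<close>
  define \<epsilon> where "\<epsilon> = Min (insert 1 ((\<lambda>q. r q / (4 * norm v)) ` Q))"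
  have vp: "norm v > 0" using v_nz by simp
  have \<epsilon>0: "\<epsilon> > 0" unfolding \<epsilon>_def using Q r vp by (subst Min_gr_iff) auto
  have \<epsilon>r: "\<epsilon> * norm v \<le> r q / 4" if "q \<in> Q" for q
  proof -
    have "\<epsilon> \<le> r q / (4 * norm v)" unfolding \<epsilon>_def using Q that by (intro Min_le) auto
    then show ?thesis using vp by (simp add: field_simps)
  qed
  show ?thesis
  proof (rule that[OF \<epsilon>0])
    fix q' assume q': "q' \<in> C"
    then obtain q where q: "q \<in> Q" "p q' \<in> V q" using Q(3) pM by blast
    then obtain u where u: "u \<in> B q" "p q' = p (\<tau> q u)" by (auto simp: V_def)
    have qC: "q \<in> C" using q Q by auto
    have uB: "u \<in> ball (dev q) (r q)" using u BO[OF qC] by auto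
    define w where "w = \<tau> q u"
    have w: "w \<in> C" "dev w = u" using sec_C[OF \<tau>(1)[OF qC] uB] sec_dev[OF \<tau>(1)[OF qC] uB] by (simp_all add: w_def)
    obtain \<gamma> \<delta> where \<gamma>: "deck_transformation C p \<gamma>" "homeomorphism C C \<gamma> \<delta>" "\<gamma> q' = w"
      using deck_transitive[OF q' w(1)] u(2) w_def by metis
    \<comment> \<open>The deck transformation brings \<open>q'\<close> to a point of the chosen
      section; pulling the ball back by \<open>hol \<gamma>\<close> may shrink it across
      \<open>v\<close>, but not along \<open>v\<close>.\<close>
    have hu: "hol \<gamma> (dev q') = u" using hol_dev[OF \<gamma>(1) q'] \<gamma>(3) w by simp
    let ?N = "hol \<gamma> -` ball (dev q) (r q)"
    have "open ?N" using affine_auto_continuous[OF hol_affine[OF \<gamma>(1)]] by (simp add: open_vimage)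
    moreover have "convex ?N" using affine_auto_convex_vimage[OF hol_affine[OF \<gamma>(1)]] by simp
    moreover have "dev q' + t *\<^sub>R v \<in> ?N" if t: "\<bar>t\<bar> \<le> \<epsilon>" for t
    proof -
      have "dist (dev q) (u + t *\<^sub>R v) \<le> dist (dev q) u + norm (t *\<^sub>R v)"
        using dist_triangle[of "dev q" "u + t *\<^sub>R v" u] by (simp add: dist_norm)
      also have "norm (t *\<^sub>R v) \<le> \<epsilon> * norm v" using t by (simp add: mult_right_mono)
      also have "dist (dev q) u + \<epsilon> * norm v < r q" using u(1) \<epsilon>r[OF q(1)] r[OF qC] by (simp add: B_def)
      finally show ?thesis by (simp add: hol_translate[OF \<gamma>(1)] hu)
    qed
    moreover have "sec ?N (\<delta> \<circ> \<tau> q \<circ> hol \<gamma>)" by (rule hol_sec[OF \<gamma>(1,2) \<tau>(1)[OF qC]])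
    moreover have "(\<delta> \<circ> \<tau> q \<circ> hol \<gamma>) (dev q') = q'"
      using hu w_def \<gamma>(3) homeomorphism_apply1[OF \<gamma>(2) q'] by simp
    ultimately show "\<exists>N \<tau>. open N \<and> convex N \<and> (\<forall>t. \<bar>t\<bar> \<le> \<epsilon> \<longrightarrow> dev q' + t *\<^sub>R v \<in> N) \<and> sec N \<tau> \<and> \<tau> (dev q') = q'"
      by blast
  qed
qed

text \<open>Orthogonal projection along \<open>v\<close>, a concrete model of the quotient of the
  space by the direction \<open>v\<close>. Balls of the quotient become cylinders.\<close>

definition proj :: "'a \<Rightarrow> 'a" where "proj u = u - ((u \<bullet> v) / (v \<bullet> v)) *\<^sub>R v"

lemma linear_proj: "linear proj"
  by (rule linearI) (auto simp: proj_def inner_add_left add_divide_distrib algebra_simps)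

lemma proj_v [simp]: "proj v = 0"
  using v_nz by (simp add: proj_def)

lemma proj_add_v [simp]: "proj (u + t *\<^sub>R v) = proj u"
  by (simp add: linear_add[OF linear_proj] linear_scale[OF linear_proj])

lemma proj_diff_v [simp]: "proj (u - t *\<^sub>R v) = proj u"
  by (simp add: linear_diff[OF linear_proj] linear_scale[OF linear_proj])

lemma continuous_on_proj [continuous_intros]: "continuous_on S f \<Longrightarrow> continuous_on S (\<lambda>x. proj (f x))"
  unfolding proj_def using v_nz by (intro continuous_intros) auto

lemma convex_cylinder: "convex {u. norm (proj (u - d)) < \<rho>}" "convex {u. norm (proj (u - d)) \<le> \<rho>}"
proof -
  have e: "{u. norm (proj (u - d)) < \<rho>} = (+) d ` (proj -` ball 0 \<rho>)"
    "{u. norm (proj (u - d)) \<le> \<rho>} = (+) d ` (proj -` cball 0 \<rho>)"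
    by (auto simp: image_iff intro!: bexI[of _ "_ - d"])
  show "convex {u. norm (proj (u - d)) < \<rho>}"
    unfolding e(1) by (intro convex_translation convex_linear_vimage[OF linear_proj] convex_ball)
  show "convex {u. norm (proj (u - d)) \<le> \<rho>}"
    unfolding e(2) by (intro convex_translation convex_linear_vimage[OF linear_proj] convex_cball)
qed

text \<open>This is completeness of the flow along \<open>v\<close> in the form needed: a local
  section spreads along \<open>v\<close> by steps of a fixed size \<epsilon>. The continuation runs
  over a closed cylinder of half the radius of a ball section.\<close>

lemma cylinder_section:
  assumes q: "q \<in> C"
  obtains \<rho> \<tau> where "\<rho> > 0" "sec {u. norm (proj (u - dev q)) < \<rho>} \<tau>" "\<tau> (dev q) = q"
proof -
  obtain r \<tau>0 where r: "r > 0" "sec (ball (dev q) r) \<tau>0" "\<tau>0 (dev q) = q"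
    using local_section[OF q] by metis
  obtain \<epsilon> where \<epsilon>: "\<epsilon> > 0"
    "\<And>q. q \<in> C \<Longrightarrow> \<exists>N \<tau>. open N \<and> convex N \<and> (\<forall>t. \<bar>t\<bar> \<le> \<epsilon> \<longrightarrow> dev q + t *\<^sub>R v \<in> N) \<and> sec N \<tau> \<and> \<tau> (dev q) = q"
    using uniform_sections by metis
  define d where "d = dev q"
  define K where "K = {u. norm (proj (u - d)) \<le> r / 2}"
  have cK: "convex K" unfolding K_def by (rule convex_cylinder)
  have clK: "closed K" unfolding K_def by (intro closed_Collect_le continuous_intros)
  have dK: "d \<in> K" using r(1) linear_0[OF linear_proj] by (simp add: K_def)
  have s0: "sec (K \<inter> ball d r) \<tau>0" using r(2) unfolding d_def by (rule lift_on_subset) auto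
  obtain \<tau> where \<tau>: "sec K \<tau>" "\<tau> d = \<tau>0 d"
  proof (rule radial_lift[OF Hausdorff_C dev_locally_injective cK clK dK r(1) s0])
    fix R s e assume R: "R \<ge> r" and s: "sec (K \<inter> ball d R) s" and e: "e \<in> K" "dist d e = R"
    define l where "l = ((e - d) \<bullet> v) / (v \<bullet> v)"
    have vv: "v \<bullet> v > 0" using v_nz by simp
    \<comment> \<open>A boundary point has distance at least r from \<open>d\<close>, but its part
      across \<open>v\<close> is at most r/2, so it can be approached along \<open>v\<close> from
      inside.\<close>
    have "l \<noteq> 0"
    proof
      assume "l = 0"
      then have "proj (e - d) = e - d" by (simp add: proj_def l_def)
      then have "R \<le> r / 2" using e by (simp add: K_def dist_norm norm_minus_commute)
      then show False using R r(1) by simp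
    qed
    \<comment> \<open>Slide from \<open>e\<close> along \<open>v\<close> towards the hyperplane
      through \<open>d\<close> orthogonal to \<open>v\<close>, stopping after \<epsilon> if it is
      farther. The squared distance to \<open>d\<close> drops by
      \<open>\<mu> * (2 * l - \<mu>)\<close> times \<open>v \<bullet> v\<close>, which
      \<open>\<mu>2\<close> shows to be positive.\<close>
    define \<mu> where "\<mu> = (if \<bar>l\<bar> \<le> \<epsilon> then l else sgn l * \<epsilon>)"
    have \<mu>1: "\<bar>\<mu>\<bar> \<le> \<epsilon>" using \<epsilon>(1) \<open>l \<noteq> 0\<close> by (auto simp: \<mu>_def abs_mult abs_sgn_eq)
    have \<mu>2: "\<mu> * (2 * l - \<mu>) > 0"
    proof (cases "l > 0")
      case True
      then show ?thesis using \<epsilon>(1) by (auto simp: \<mu>_def)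
    next
      case False
      then have "l < 0" using \<open>l \<noteq> 0\<close> by simp
      then show ?thesis using \<epsilon>(1) by (auto simp: \<mu>_def mult_neg_neg zero_less_mult_iff)
    qed
    define x where "x = e - \<mu> *\<^sub>R v"
    have xK: "x \<in> K"
    proof -
      have "x - d = (e - d) - \<mu> *\<^sub>R v" by (simp add: x_def)
      then have "proj (x - d) = proj (e - d)" by (simp only: proj_diff_v)
      then show ?thesis using e(1) by (simp add: K_def)
    qed
    have xR: "x \<in> ball d R"
    proof -
      have "(norm (x - d))\<^sup>2 = (norm (e - d))\<^sup>2 - 2 * \<mu> * ((e - d) \<bullet> v) + \<mu>\<^sup>2 * (v \<bullet> v)"
        unfolding x_def power2_norm_eq_inner
        by (simp add: inner_diff_left inner_diff_right inner_commute power2_eq_square algebra_simps)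
      also have "(e - d) \<bullet> v = l * (v \<bullet> v)" using vv by (simp add: l_def)
      also have "(norm (e - d))\<^sup>2 - 2 * \<mu> * (l * (v \<bullet> v)) + \<mu>\<^sup>2 * (v \<bullet> v) = (norm (e - d))\<^sup>2 - (\<mu> * (2 * l - \<mu>)) * (v \<bullet> v)"
        by (simp add: power2_eq_square algebra_simps)
      also have "\<dots> < (norm (e - d))\<^sup>2" using \<mu>2 vv by simp
      finally have "norm (x - d) < norm (e - d)" by (rule power2_less_imp_less) simp
      then show ?thesis using e(2) by (simp add: dist_norm norm_minus_commute)
    qed
    have sx: "s x \<in> C" "dev (s x) = x" using sec_C[OF s] sec_dev[OF s] xK xR by auto
    obtain N \<tau>' where N: "open N" "convex N" "\<And>t. \<bar>t\<bar> \<le> \<epsilon> \<Longrightarrow> x + t *\<^sub>R v \<in> N" "sec N \<tau>'" "\<tau>' x = s x"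
      using \<epsilon>(2)[OF sx(1)] sx(2) by metis
    have "e \<in> N" using N(3)[OF \<mu>1] by (simp add: x_def)
    moreover have "x \<in> N" using N(3)[of 0] \<epsilon>(1) by simp
    moreover have "sec (K \<inter> N) \<tau>'" using N(4) by (rule lift_on_subset) auto
    ultimately show "\<exists>N \<tau> x. open N \<and> convex N \<and> e \<in> N \<and> sec (K \<inter> N) \<tau> \<and> x \<in> K \<inter> N \<inter> ball d R \<and> \<tau> x = s x"
      using N xK xR by blast
  qed (rule that)
  show ?thesis
  proof (rule that)
    show "r / 2 > 0" using r by simp
    show "sec {u. norm (proj (u - dev q)) < r / 2} \<tau>"
      using \<tau>(1) by (rule lift_on_subset) (auto simp: K_def d_def)
    show "\<tau> (dev q) = q" using \<tau>(2) r(3) by (simp add: d_def)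
  qed
qed

end

subsection \<open>Groups of translations along a line\<close>

text \<open>A cocompact proper action by translations along a line splits the space into a positive and a
  negative part with bounded overlap, which contradicts one-endedness.\<close>

lemma no_cocompact_translation_group:
  fixes G :: "('a::euclidean_space \<Rightarrow> 'a) set" and f :: "('a \<Rightarrow> 'a) \<Rightarrow> real"
  assumes dim: "2 \<le> DIM('a)" and v: "v \<noteq> 0"
    and cont: "\<And>g. g \<in> G \<Longrightarrow> continuous_on UNIV g"
    and inv: "\<And>g. g \<in> G \<Longrightarrow> \<exists>g'\<in>G. \<forall>x. g' (g x) = x \<and> g (g' x) = x"
    and comp: "\<And>g h. g \<in> G \<Longrightarrow> h \<in> G \<Longrightarrow> g \<circ> h \<in> G"
    and trans: "\<And>g t. g \<in> G \<Longrightarrow> g (a + t *\<^sub>R v) = a + (t + f g) *\<^sub>R v"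
    and proper: "\<And>K. compact K \<Longrightarrow> finite {g \<in> G. g ` K \<inter> K \<noteq> {}}"
    and cover: "(\<Union>g\<in>G. g ` ball a R) = UNIV"
  shows False
proof -
  have R: "R > 0"
  proof (rule ccontr)
    assume "\<not> R > 0"
    then have "ball a R = {}" by simp
    from cover[unfolded this] show False by simp
  qed
  have ga: "g a = a + f g *\<^sub>R v" if "g \<in> G" for g using trans[OF that, of 0] by simp
  have fcomp: "f (g \<circ> h) = f g + f h" if "g \<in> G" "h \<in> G" for g h
  proof -
    have "a + f (g \<circ> h) *\<^sub>R v = g (h a)" using ga[OF comp[OF that]] by simp
    also have "\<dots> = a + (f h + f g) *\<^sub>R v" unfolding ga[OF that(2)] by (rule trans[OF that(1)])
    finally show ?thesis using v by simp
  qed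
  have finv: "\<exists>g'\<in>G. (\<forall>x. g' (g x) = x \<and> g (g' x) = x) \<and> f g' = - f g" if g: "g \<in> G" for g
  proof -
    obtain g' where g': "g' \<in> G" "\<forall>x. g' (g x) = x \<and> g (g' x) = x" using inv[OF g] by blast
    have "a = a + (f g + f g') *\<^sub>R v"
      using ga[OF g] trans[OF g'(1), of "f g"] g'(2) by metis
    then have "f g' = - f g" using v by (simp add: add_eq_0_iff)
    then show ?thesis using g' by blast
  qed
  have opn: "open (g ` ball a R)" if g: "g \<in> G" for g
  proof -
    obtain g' where g': "g' \<in> G" "\<forall>x. g' (g x) = x \<and> g (g' x) = x" using inv[OF g] by blast
    have "g ` ball a R = g' -` ball a R"
    proof (intro set_eqI iffI)
      show "x \<in> g ` ball a R" if "x \<in> g' -` ball a R" for x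
        using that g'(2) by (metis image_eqI vimageE)
    qed (use g'(2) in auto)
    then show ?thesis using cont[OF g'(1)] by (simp add: open_vimage)
  qed
  \<comment> \<open>An element with translation number at most S in absolute value moves
    \<open>a\<close> within a fixed closed ball, so properness leaves finitely many.\<close>
  have fin: "finite {g \<in> G. \<bar>f g\<bar> \<le> S}" for S
  proof (rule finite_subset)
    let ?K = "cball a (S * norm v)"
    show "{g \<in> G. \<bar>f g\<bar> \<le> S} \<subseteq> {g \<in> G. g ` ?K \<inter> ?K \<noteq> {}}"
    proof safe
      fix g assume g: "g \<in> G" "\<bar>f g\<bar> \<le> S" and e: "g ` ?K \<inter> ?K = {}"
      have "0 \<le> S" using g by simp
      then have "a \<in> ?K" by simp
      moreover have "g a \<in> ?K" using g by (simp add: ga dist_norm mult_right_mono)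
      ultimately show False using e by blast
    qed
    show "finite {g \<in> G. g ` ?K \<inter> ?K \<noteq> {}}" using proper by simp
  qed
  have bdd: "bounded (\<Union>g\<in>{g \<in> G. \<bar>f g\<bar> \<le> S}. g ` ball a R)" for S
  proof -
    have "bounded (g ` ball a R)" if "g \<in> G" for g
    proof -
      have "compact (g ` cball a R)"
        using cont[OF that] by (intro compact_continuous_image) (auto intro: continuous_on_subset)
      then show ?thesis by (rule bounded_subset[OF compact_imp_bounded]) auto
    qed
    then show ?thesis using fin by (intro bounded_UN) auto
  qed
  define F where "F = {g \<in> G. g ` cball a R \<inter> cball a R \<noteq> {}}"
  have "finite F" unfolding F_def by (rule proper) simp
  \<comment> \<open>\<open>S\<close> bounds the translation numbers of the elements whose translate
    of the closed ball meets that ball; it controls the overlap of \<open>P\<close> and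
    \<open>N\<close>.\<close>
  then obtain S where S: "\<And>g. g \<in> F \<Longrightarrow> f g \<le> S"
    using finite_imp_bounded[of "f ` F"] bounded_real by (metis abs_le_iff finite_imageI image_eqI)
  define P where "P = (\<Union>g\<in>{g \<in> G. f g \<ge> 0}. g ` ball a R)"
  define N where "N = (\<Union>g\<in>{g \<in> G. f g < 0}. g ` ball a R)"
  have PN: "open P" "open N" using opn by (auto simp: P_def N_def)
  have PNU: "P \<union> N = UNIV"
  proof -
    have "x \<in> P \<union> N" for x
    proof -
      have "x \<in> (\<Union>g\<in>G. g ` ball a R)" using cover by simp
      then obtain g where "g \<in> G" "x \<in> g ` ball a R" by blast
      then show ?thesis by (cases "f g \<ge> 0") (auto simp: P_def N_def)
    qed
    then show ?thesis by blast
  qed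
  \<comment> \<open>If translates by \<open>g\<close> and \<open>h\<close> meet, the inverse of
    \<open>h\<close> composed with \<open>g\<close> lies in \<open>F\<close>, so f g - f h \<le> S;
    with f h < 0 \<le> f g this confines f g to a bounded range.\<close>
  have "P \<inter> N \<subseteq> (\<Union>g\<in>{g \<in> G. \<bar>f g\<bar> \<le> S}. g ` ball a R)"
  proof
    fix x assume "x \<in> P \<inter> N"
    then obtain g h y z where g: "g \<in> G" "f g \<ge> 0" "y \<in> ball a R" "x = g y"
      and h: "h \<in> G" "f h < 0" "z \<in> ball a R" "x = h z" unfolding P_def N_def by auto
    obtain h' where h': "h' \<in> G" "\<forall>x. h' (h x) = x \<and> h (h' x) = x" "f h' = - f h" using finv[OF h(1)] by blast
    have "(h' \<circ> g) y = z" using g(4) h(4) h'(2) by (metis comp_apply)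
    then have "(h' \<circ> g) ` cball a R \<inter> cball a R \<noteq> {}" using g(3) h(3) by force
    then have "h' \<circ> g \<in> F" using comp[OF h'(1) g(1)] by (simp add: F_def)
    from S[OF this] have "f g \<le> S" using fcomp[OF h'(1) g(1)] h'(3) h(2) by simp
    then show "x \<in> (\<Union>g\<in>{g \<in> G. \<bar>f g\<bar> \<le> S}. g ` ball a R)" using g by auto
  qed
  then have "bounded (P \<inter> N)" using bdd bounded_subset by blast
  then obtain B where B: "\<And>x. x \<in> P \<inter> N \<Longrightarrow> norm x \<le> B" unfolding bounded_iff by blast
  \<comment> \<open>One-endedness, where dimension at least two enters: outside a ball containing
    the overlap, only one of \<open>P\<close> and \<open>N\<close> can survive.\<close>
  have con: "connected (- cball (0::'a) B)"
    by (rule connected_complement_bounded_convex) (use dim in auto)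
  have alt: "P \<inter> - cball 0 B = {} \<or> N \<inter> - cball 0 B = {}"
    by (rule connectedD[OF con PN]) (use B PNU in auto)
  show False
  proof (cases "\<forall>g\<in>G. f g = 0")
    case True
    then have "{g \<in> G. \<bar>f g\<bar> \<le> 0} = G" by auto
    then have "bounded (UNIV :: 'a set)" using bdd[of 0] cover by simp
    then show False by simp
  next
    case False
    then obtain g1 where g1: "g1 \<in> G" "f g1 \<noteq> 0" by blast
    obtain g0 where g0: "g0 \<in> G" "f g0 > 0"
    proof (cases "f g1 > 0")
      case True
      then show ?thesis using g1 that by blast
    next
      case False
      then have "- f g1 > 0" using g1 by simp
      then show ?thesis using finv[OF g1(1)] that by metis
    qed
    \<comment> \<open>Iterates of \<open>g0\<close> and their inverses push \<open>a\<close>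
      arbitrarily far both ways along the line, so \<open>P\<close> and \<open>N\<close> both reach
      outside every ball.\<close>
    have pow: "\<exists>g\<in>G. f g = real (Suc n) * f g0" for n
    proof (induction n)
      case 0
      then show ?case using g0 by auto
    next
      case (Suc n)
      then obtain g where "g \<in> G" "f g = real (Suc n) * f g0" by blast
      then have "g0 \<circ> g \<in> G" "f (g0 \<circ> g) = real (Suc (Suc n)) * f g0"
        using comp fcomp g0 by (auto simp: algebra_simps)
      then show ?case by blast
    qed
    have "0 < f g0 * norm v" using g0 v by simp
    then obtain n where n: "B + norm a < real n * (f g0 * norm v)" using reals_Archimedean3 by metis
    have big: "a + c *\<^sub>R v \<in> - cball 0 B" if "\<bar>c\<bar> = real (Suc n) * f g0" for c
    proof -
      have "B + norm a < real (Suc n) * (f g0 * norm v)"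
        using n \<open>0 < f g0 * norm v\<close> by (simp add: algebra_simps)
      also have "\<dots> = norm (c *\<^sub>R v)" using that by (simp add: algebra_simps)
      also have "\<dots> \<le> norm (a + c *\<^sub>R v) + norm a"
        using norm_triangle_ineq4[of "a + c *\<^sub>R v" a] by simp
      finally show ?thesis by simp
    qed
    have aO: "a \<in> ball a R" using R by simp
    obtain g where g: "g \<in> G" "f g = real (Suc n) * f g0" using pow by blast
    obtain g' where g': "g' \<in> G" "f g' = - f g" using finv[OF g(1)] by blast
    have pos: "real (Suc n) * f g0 > 0" using g0 by simp
    have "g a \<in> P" unfolding P_def using g pos aO by auto
    moreover have "g a \<in> - cball 0 B" unfolding ga[OF g(1)] using g(2) pos by (intro big) simp
    moreover have "g' a \<in> N" unfolding N_def using g' g pos aO by auto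
    moreover have "g' a \<in> - cball 0 B" unfolding ga[OF g'(1)] using g(2) g'(2) pos by (intro big) simp
    ultimately show False using alt by blast
  qed
qed

subsection \<open>The developing image\<close>

context affine_universal_cover
begin

text \<open>A cluster point of \<open>c t\<close> as t tends to 1 from the left, obtained from the
  filter form of compactness.\<close>

lemma accumulation_point:
  assumes c: "\<And>t. 0 \<le> t \<Longrightarrow> t < 1 \<Longrightarrow> c t \<in> M"
  obtains m where "m \<in> M"
    "\<And>U \<eta>. openin (top_of_set M) U \<Longrightarrow> m \<in> U \<Longrightarrow> \<eta> < (1::real) \<Longrightarrow> \<exists>t. \<eta> < t \<and> 0 < t \<and> t < 1 \<and> c t \<in> U"
proof -
  have ev: "eventually (\<lambda>t. \<eta> < t \<and> 0 < t \<and> t < 1) (at_left (1::real))" if "\<eta> < 1" for \<eta>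
    using eventually_at_left_real[of "max \<eta> 0" 1] that by (auto elim: eventually_mono)
  define F where "F = filtermap c (at_left 1)"
  have "F \<noteq> bot" by (simp add: F_def filtermap_bot_iff)
  moreover have "eventually (\<lambda>x. x \<in> M) F"
    unfolding F_def eventually_filtermap using ev[of 0] c by (auto elim!: eventually_mono)
  ultimately obtain m where m: "m \<in> M" "inf (nhds m) F \<noteq> bot"
    using compact_M unfolding compact_filter by blast
  show ?thesis
  proof (rule that[OF m(1)])
    fix U and \<eta> :: real
    assume U: "openin (top_of_set M) U" "m \<in> U" and \<eta>: "\<eta> < 1"
    obtain T where T: "open T" "U = M \<inter> T" using U(1) unfolding openin_open by blast
    show "\<exists>t. \<eta> < t \<and> 0 < t \<and> t < 1 \<and> c t \<in> U"
    proof (rule ccontr)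
      assume *: "\<not> ?thesis"
      have "eventually (\<lambda>t. c t \<notin> T) (at_left 1)"
        using ev[OF \<eta>] by (rule eventually_mono) (use * c T(2) in auto)
      then have "eventually (\<lambda>x. x \<notin> T) F" unfolding F_def eventually_filtermap .
      moreover have "eventually (\<lambda>x. x \<in> T) (nhds m)" using T U by (intro eventually_nhds_in_open) auto
      ultimately have "eventually (\<lambda>_. False) (inf (nhds m) F)"
        unfolding eventually_inf by (intro exI[of _ "\<lambda>x. x \<in> T"] exI[of _ "\<lambda>x. x \<notin> T"]) auto
      then show False using m(2) by (simp add: trivial_limit_def)
    qed
  qed
qed

text \<open>If the radial lift from \<open>q0\<close> stopped at \<open>e\<close>, the lifted segment would accumulate in \<open>M\<close>.  Modulo
  \<open>v\<close> the holonomy acts linearly with origin the line, so a deck transformation carries \<open>e\<close> into a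
  cylinder over which a section exists.\<close>

lemma global_section:
  assumes q0: "q0 \<in> C" "dev q0 = a + t0 *\<^sub>R v"
  obtains s where "sec UNIV s" "s (dev q0) = q0"
proof -
  define b where "b = dev q0"
  have pC: "continuous_on C p" "p ` C = M" using cov by (auto simp: covering_space_def)
  obtain r0 \<tau>0 where r0: "r0 > 0" "sec (ball b r0) \<tau>0" "\<tau>0 b = q0"
    using local_section[OF q0(1)] unfolding b_def by metis
  have s0: "sec (UNIV \<inter> ball b r0) \<tau>0" using r0 by simp
  obtain s where "sec UNIV s" "s b = \<tau>0 b"
  proof (rule radial_lift[OF Hausdorff_C dev_locally_injective convex_UNIV closed_UNIV UNIV_I r0(1) s0])
    fix R s e assume R: "R \<ge> r0" and s: "sec (UNIV \<inter> ball b R) s" and e: "dist b e = R"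
    define u where "u t = b + t *\<^sub>R (e - b)" for t
    have Rp: "R > 0" using R r0 by simp
    have uR: "u t \<in> UNIV \<inter> ball b R" if "0 \<le> t" "t < 1" for t
      using that e Rp by (simp add: u_def dist_norm norm_minus_commute)
    have su: "s (u t) \<in> C" "dev (s (u t)) = u t" if "0 \<le> t" "t < 1" for t
      using sec_C[OF s uR[OF that]] sec_dev[OF s uR[OF that]] by auto
    obtain m where m: "m \<in> M" "\<And>U \<eta>. openin (top_of_set M) U \<Longrightarrow> m \<in> U \<Longrightarrow> \<eta> < 1 \<Longrightarrow>
        \<exists>t. \<eta> < t \<and> 0 < t \<and> t < 1 \<and> p (s (u t)) \<in> U"
    proof (rule accumulation_point[of "\<lambda>t. p (s (u t))"])
      show "p (s (u t)) \<in> M" if "0 \<le> t" "t < 1" for t using su(1)[OF that] pC by blast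
    qed (rule that)
    obtain q where q: "q \<in> C" "p q = m" using m(1) pC by blast
    define d where "d = dev q"
    obtain \<rho> \<tau> where \<rho>: "\<rho> > 0" and \<tau>: "sec {u. norm (proj (u - d)) < \<rho>} \<tau>" "\<tau> d = q"
      using cylinder_section[OF q(1)] unfolding d_def by metis
    obtain r1 \<tau>1 where r1: "r1 > 0" "sec (ball d r1) \<tau>1" "\<tau>1 d = q"
      "\<And>U. open U \<Longrightarrow> U \<subseteq> ball d r1 \<Longrightarrow> openin (top_of_set C) (\<tau>1 ` U)"
      using local_section[OF q(1)] unfolding d_def by metis
    define Z where "Z = {u. norm (proj (u - d)) < \<rho>}"
    \<comment> \<open>Half of the cylinder leaves room for the passage from \<open>y\<close> to
      \<open>h e\<close>. The ball is added because \<open>\<tau>1\<close> is known to be an open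
      map there, so that \<open>Y\<close> projects to a neighbourhood of \<open>m\<close>; by
      \<open>\<tau>\<tau>1\<close> the two sections coincide on \<open>Y\<close>.\<close>
    define Y where "Y = {u. norm (proj (u - d)) < \<rho> / 2} \<inter> ball d r1"
    have cY: "convex Y" unfolding Y_def by (intro convex_Int convex_cylinder convex_ball)
    have cZ: "convex Z" unfolding Z_def by (rule convex_cylinder)
    have oY: "open Y" unfolding Y_def by (intro open_Int open_Collect_less continuous_intros open_ball)
    have oZ: "open Z" unfolding Z_def by (intro open_Collect_less continuous_intros)
    have dY: "d \<in> Y" using \<rho> r1(1) linear_0[OF linear_proj] by (simp add: Y_def)
    have YZ: "Y \<subseteq> Z" using \<rho> by (auto simp: Y_def Z_def)
    have \<tau>\<tau>1: "\<tau>1 y = \<tau> y" if "y \<in> Y" for y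
    proof (rule sec_unique[of Y "\<lambda>x. x" \<tau>1 \<tau> d y])
      show "sec Y \<tau>1" using r1(2) by (rule lift_on_subset) (auto simp: Y_def)
      show "sec Y \<tau>" using \<tau>(1) by (rule lift_on_subset) (use YZ in \<open>auto simp: Z_def\<close>)
    qed (use cY dY r1 \<tau> that in \<open>auto intro: convex_connected\<close>)
    have opp: "openin (top_of_set M) (p ` \<tau>1 ` Y)"
      using oY by (intro covering_open_map[OF cov] r1(4)) (auto simp: Y_def)
    have mp: "m \<in> p ` \<tau>1 ` Y" using dY r1(3) q(2) by (metis image_eqI)
    \<comment> \<open>\<open>L\<close> bounds the distance, modulo \<open>v\<close>, from the points
      of \<open>Y\<close> to the line; \<eta> is chosen so that (1/t - 1) L \<le> \<rho>/2 for all t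
      beyond it.\<close>
    define L where "L = \<rho> / 2 + norm (proj (d - a))"
    have L: "L > 0" using \<rho> by (simp add: L_def add_pos_nonneg)
    define \<eta> where "\<eta> = L / (L + \<rho> / 2)"
    have "\<eta> < 1" using L \<rho> by (simp add: \<eta>_def)
    then obtain t where t: "\<eta> < t" "0 < t" "t < 1" "p (s (u t)) \<in> p ` \<tau>1 ` Y"
      using m(2)[OF opp mp] by blast
    then obtain y where y: "y \<in> Y" "p (s (u t)) = p (\<tau>1 y)" by blast
    define w where "w = \<tau> y"
    have yZ: "y \<in> {u. norm (proj (u - d)) < \<rho>}" using y(1) YZ Z_def by auto
    have w: "w \<in> C" "dev w = y" "p w = p (s (u t))"
      using sec_C[OF \<tau>(1) yZ] sec_dev[OF \<tau>(1) yZ] \<tau>\<tau>1[OF y(1)] y(2) by (simp_all add: w_def)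
    have sut: "s (u t) \<in> C" "dev (s (u t)) = u t" using su[of t] t by auto
    obtain \<gamma> \<delta> where \<gamma>: "deck_transformation C p \<gamma>" "homeomorphism C C \<gamma> \<delta>" "\<gamma> (s (u t)) = w"
      using deck_transitive[OF sut(1) w(1,3)] by metis
    define h where "h = hol \<gamma>"
    have h: "affine_auto h" using hol_affine[OF \<gamma>(1)] by (simp add: h_def)
    have hu: "h (u t) = y" using hol_dev[OF \<gamma>(1) sut(1)] \<gamma>(3) w(2) sut(2) by (simp add: h_def)
    obtain s' where s': "\<And>t. h (a + t *\<^sub>R v) = a + (t + s') *\<^sub>R v" using translation[OF \<gamma>(1)] unfolding h_def by blast
    \<comment> \<open>Here it matters that the segment starts on the line: \<open>h\<close> moves
      \<open>b\<close> along the line by the unknown length \<open>s'\<close>, which disappears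
      modulo \<open>v\<close>.\<close>
    have hb: "h b = a + (t0 + s') *\<^sub>R v" using s'[of t0] q0(2) by (simp add: b_def)
    have "u t = (1 - t) *\<^sub>R b + t *\<^sub>R e" by (simp add: u_def algebra_simps)
    then have yy: "y = (1 - t) *\<^sub>R h b + t *\<^sub>R h e" using affine_auto_comb[OF h, of t b e] hu by simp
    have pl: "proj (x - z) = proj x - proj z" "proj (c *\<^sub>R x) = c *\<^sub>R proj x" "proj (x + z) = proj x + proj z" for x z c
      using linear_diff[OF linear_proj] linear_scale[OF linear_proj] linear_add[OF linear_proj] by auto
    have phb: "proj (h b) = proj a" unfolding hb by simp
    \<comment> \<open>Modulo \<open>v\<close>, \<open>h e\<close> is the dilate of \<open>y\<close>
      by 1/t centred at the image of the line. As t is close to 1 and \<open>y\<close> stays within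
      \<open>L\<close> of the line, \<open>h e\<close> remains in the cylinder
      \<open>Z\<close>.\<close>
    have pe: "t *\<^sub>R (proj (h e) - proj a) = proj y - proj a"
      unfolding yy pl phb by (simp add: algebra_simps)
    have e1: "proj (h e - d) = (1 / t - 1) *\<^sub>R proj (y - a) + proj (y - d)"
    proof -
      have "proj (h e) - proj a = (1 / t) *\<^sub>R (t *\<^sub>R (proj (h e) - proj a))" using t(2) by simp
      then have "proj (h e) - proj a = (1 / t) *\<^sub>R (proj y - proj a)" unfolding pe .
      then have "proj (h e) = (1 / t) *\<^sub>R (proj y - proj a) + proj a" by (simp add: algebra_simps)
      then show ?thesis unfolding pl by (simp add: algebra_simps)
    qed
    have ny: "norm (proj (y - d)) < \<rho> / 2" using y(1) by (simp add: Y_def)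
    have "norm (proj (y - a)) \<le> norm (proj (y - d)) + norm (proj (d - a))"
      using norm_triangle_ineq[of "proj (y - d)" "proj (d - a)"] by (simp add: pl)
    then have nL: "norm (proj (y - a)) \<le> L" using ny by (simp add: L_def)
    have tt: "0 \<le> 1 / t - 1" "(1 / t - 1) * L \<le> \<rho> / 2"
    proof -
      show "0 \<le> 1 / t - 1" using t by simp
      have "L < t * (L + \<rho> / 2)" using t(1) L \<rho> by (simp add: \<eta>_def field_simps)
      then show "(1 / t - 1) * L \<le> \<rho> / 2"
        using t(2) by (simp add: field_simps)
    qed
    have "norm (proj (h e - d)) \<le> (1 / t - 1) * norm (proj (y - a)) + norm (proj (y - d))"
      unfolding e1 using tt(1) by (metis abs_of_nonneg norm_scaleR norm_triangle_ineq)
    also have "\<dots> \<le> (1 / t - 1) * L + norm (proj (y - d))" using nL tt(1) by (simp add: mult_left_mono)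
    also have "\<dots> < \<rho>" using tt(2) ny by linarith
    finally have he: "h e \<in> Z" by (simp add: Z_def)
    \<comment> \<open>Pulled back, the cylinder is a convex open set containing both
      \<open>e\<close> and \<open>u t\<close>, and the transported section takes the value
      \<open>s (u t)\<close> at the latter.\<close>
    let ?N = "h -` Z"
    have "open ?N" using affine_auto_continuous[OF h] oZ by (simp add: open_vimage)
    moreover have "convex ?N" using affine_auto_convex_vimage[OF h cZ] .
    moreover have "e \<in> ?N" using he by simp
    moreover have "sec (UNIV \<inter> ?N) (\<delta> \<circ> \<tau> \<circ> h)" using hol_sec[OF \<gamma>(1,2) \<tau>(1)] by (simp add: h_def Z_def)
    moreover have "u t \<in> UNIV \<inter> ?N \<inter> ball b R" using hu y(1) YZ uR[of t] t by auto
    moreover have "(\<delta> \<circ> \<tau> \<circ> h) (u t) = s (u t)"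
      using hu homeomorphism_apply1[OF \<gamma>(2) sut(1)] \<gamma>(3) by (simp add: w_def)
    ultimately show "\<exists>N \<tau> x. open N \<and> convex N \<and> e \<in> N \<and> sec (UNIV \<inter> N) \<tau> \<and> x \<in> UNIV \<inter> N \<inter> ball b R \<and> \<tau> x = s x"
      by blast
  qed (rule that)
  then show ?thesis using that r0(3) by (simp add: b_def)
qed

section \<open>The holonomy group acting on the whole affine space\<close>

lemma deck_compose:
  assumes "deck_transformation C p \<gamma>" "deck_transformation C p \<gamma>'"
  shows "deck_transformation C p (\<gamma> \<circ> \<gamma>')"
proof -
  obtain \<delta> \<delta>' where d: "homeomorphism C C \<gamma> \<delta>" "homeomorphism C C \<gamma>' \<delta>'"
    using assms by (auto simp: deck_transformation_def)
  have "\<gamma>' x \<in> C" if "x \<in> C" for x using d(2) that by (auto simp: homeomorphism_def)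
  then show ?thesis
    using assms homeomorphism_compose[OF d(2,1)] by (auto simp: deck_transformation_def)
qed

lemma deck_inverse:
  assumes "deck_transformation C p \<gamma>"
  obtains \<delta> where "deck_transformation C p \<delta>" "\<And>x. x \<in> C \<Longrightarrow> \<delta> (\<gamma> x) = x" "\<And>x. x \<in> C \<Longrightarrow> \<gamma> (\<delta> x) = x"
    "\<And>x. x \<in> C \<Longrightarrow> \<gamma> x \<in> C" "\<And>x. x \<in> C \<Longrightarrow> \<delta> x \<in> C"
proof -
  obtain \<delta> where d: "homeomorphism C C \<gamma> \<delta>" and p: "\<And>x. x \<in> C \<Longrightarrow> p (\<gamma> x) = p x"
    using assms by (auto simp: deck_transformation_def)
  have in_C: "\<gamma> x \<in> C" "\<delta> x \<in> C" if "x \<in> C" for x using d that by (auto simp: homeomorphism_def)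
  have eq: "\<delta> (\<gamma> x) = x" "\<gamma> (\<delta> x) = x" if "x \<in> C" for x
    using homeomorphism_apply1[OF d that] homeomorphism_apply2[OF d that] by auto
  have "p (\<delta> x) = p x" if "x \<in> C" for x
    using p[OF in_C(2)[OF that]] eq(2)[OF that] by simp
  then have "deck_transformation C p \<delta>"
    using homeomorphism_sym[of C C \<gamma> \<delta>] d unfolding deck_transformation_def by blast
  then show ?thesis using that eq in_C by blast
qed

text \<open>Deck transformations are lifts of \<open>p\<close> through itself, so uniqueness of
  lifts applies.\<close>

lemma deck_eqI:
  assumes "deck_transformation C p \<gamma>" "deck_transformation C p \<gamma>'" "x \<in> C" "\<gamma> x = \<gamma>' x" "y \<in> C"
  shows "\<gamma> y = \<gamma>' y"
proof (rule lift_unique[OF Hausdorff_C covering_locally_injective[OF cov] path_connected_imp_connected[OF pcC],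
      where f = p and ?s1.0 = \<gamma> and ?s2.0 = \<gamma>' and a = x])
  have "lift_on p p C C \<gamma>" if "deck_transformation C p \<gamma>" for \<gamma>
    using that by (auto simp: deck_transformation_def homeomorphism_def lift_on_def)
  then show "lift_on p p C C \<gamma>" "lift_on p p C C \<gamma>'" using assms by auto
qed (use assms in auto)

text \<open>A meeting point makes \<open>dev\<close> a bijection with continuous inverse
  \<open>s\<close>. The deck group then becomes the group \<open>G\<close> of affine maps of the
  whole space, with \<open>p \<circ> s\<close> as quotient map onto \<open>M\<close>; the rest
  verifies the hypotheses of \<open>no_cocompact_translation_group\<close>.\<close>

theorem dev_avoids_line:
  assumes dim: "2 \<le> DIM('a)"
  shows "dev ` C \<inter> {a + t *\<^sub>R v | t::real. True} = {}"
proof (rule ccontr)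
  assume "\<not> ?thesis"
  then obtain q0 t0 where q0: "q0 \<in> C" "dev q0 = a + t0 *\<^sub>R v" by blast
  obtain s where s: "sec UNIV s" "s (dev q0) = q0" using global_section[OF q0] by blast
  have pC: "continuous_on C p" "p ` C = M" using cov by (auto simp: covering_space_def)
  have sC: "s x \<in> C" and devs: "dev (s x) = x" for x using sec_C[OF s(1)] sec_dev[OF s(1)] by auto
  have cs: "continuous_on UNIV s" using s by (simp add: lift_on_def)
  have cdev: "continuous_on C dev" using dev_map by (simp add: developing_map_def)
  \<comment> \<open>Both \<open>s \<circ> dev\<close> and the identity lift \<open>dev\<close>
    through itself, and they agree at \<open>q0\<close>.\<close>
  have sdev: "s (dev c) = c" if c: "c \<in> C" for c
  proof -
    have "(s \<circ> dev) c = (\<lambda>x. x) c"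
    proof (rule sec_unique[OF path_connected_imp_connected[OF pcC]])
      show "lift_on ((\<lambda>x. x) \<circ> dev) dev C C (s \<circ> dev)" by (rule lift_on_compose[OF s(1) cdev]) simp
      show "lift_on ((\<lambda>x. x) \<circ> dev) dev C C (\<lambda>x. x)" by (auto simp: lift_on_def)
      show "(s \<circ> dev) q0 = q0" using s by simp
    qed (use q0 c in auto)
    then show ?thesis by simp
  qed
  define \<pi> where "\<pi> = p \<circ> s"
  have c\<pi>: "continuous_on UNIV \<pi>" "\<pi> x \<in> M" for x
    using covering_compose[OF cov cs] sC by (auto simp: \<pi>_def)
  define G where "G = hol ` {\<gamma>. deck_transformation C p \<gamma>}"
  have Gs: "hol \<gamma> x = dev (\<gamma> (s x))" if "deck_transformation C p \<gamma>" for \<gamma> x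
    using hol_dev[OF that sC, of x] devs by simp
  have \<pi>G: "\<pi> (g x) = \<pi> x" if g: "g \<in> G" for g x
  proof -
    obtain \<gamma> where \<gamma>: "deck_transformation C p \<gamma>" "g = hol \<gamma>" using g by (auto simp: G_def)
    obtain \<delta> where "\<gamma> (s x) \<in> C" using deck_inverse[OF \<gamma>(1)] sC by metis
    then have "s (g x) = \<gamma> (s x)" using Gs[OF \<gamma>(1)] sdev \<gamma>(2) by simp
    then show ?thesis using \<gamma>(1) sC by (simp add: \<pi>_def deck_transformation_def)
  qed
  have Gtr: "\<exists>g\<in>G. g x = y" if xy: "\<pi> x = \<pi> y" for x y
  proof -
    obtain \<gamma> \<delta> where "deck_transformation C p \<gamma>" "homeomorphism C C \<gamma> \<delta>" "\<gamma> (s x) = s y"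
      using deck_transitive[of "s x" "s y"] sC xy by (metis \<pi>_def comp_apply)
    then show ?thesis using Gs devs by (auto simp: G_def)
  qed
  have Gfree: "g = g'" if g: "g \<in> G" "g' \<in> G" and x: "g x = g' x" for g g' x
  proof -
    obtain \<gamma> \<gamma>' where \<gamma>: "deck_transformation C p \<gamma>" "g = hol \<gamma>" "deck_transformation C p \<gamma>'" "g' = hol \<gamma>'"
      using g by (auto simp: G_def)
    have "\<gamma> (s x) \<in> C" "\<gamma>' (s x) \<in> C" using deck_inverse[OF \<gamma>(1)] deck_inverse[OF \<gamma>(3)] sC by metis+
    moreover have "dev (\<gamma> (s x)) = dev (\<gamma>' (s x))" using x Gs \<gamma> by simp
    ultimately have "\<gamma> (s x) = \<gamma>' (s x)" using sdev by metis
    then have "\<gamma> (s y) = \<gamma>' (s y)" for y using deck_eqI[OF \<gamma>(1,3) sC _ sC] by blast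
    then show ?thesis using Gs \<gamma> by auto
  qed
  have Gcont: "continuous_on UNIV g" if "g \<in> G" for g
    using that hol_affine affine_auto_continuous by (auto simp: G_def)
  have Ginv: "\<exists>g'\<in>G. \<forall>x. g' (g x) = x \<and> g (g' x) = x" if g: "g \<in> G" for g
  proof -
    obtain \<gamma> where \<gamma>: "deck_transformation C p \<gamma>" "g = hol \<gamma>" using g by (auto simp: G_def)
    obtain \<delta> where \<delta>: "deck_transformation C p \<delta>" "\<And>x. x \<in> C \<Longrightarrow> \<delta> (\<gamma> x) = x" "\<And>x. x \<in> C \<Longrightarrow> \<gamma> (\<delta> x) = x"
        "\<And>x. x \<in> C \<Longrightarrow> \<gamma> x \<in> C" "\<And>x. x \<in> C \<Longrightarrow> \<delta> x \<in> C"
      using deck_inverse[OF \<gamma>(1)] by blast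
    have "hol \<delta> (g x) = x \<and> g (hol \<delta> x) = x" for x
      using Gs[OF \<gamma>(1)] Gs[OF \<delta>(1)] \<delta> \<gamma>(2) sC sdev devs by simp
    then show ?thesis using \<delta>(1) by (auto simp: G_def)
  qed
  have Gcomp: "g \<circ> h \<in> G" if gh: "g \<in> G" "h \<in> G" for g h
  proof -
    obtain \<gamma> \<gamma>' where \<gamma>: "deck_transformation C p \<gamma>" "g = hol \<gamma>" "deck_transformation C p \<gamma>'" "h = hol \<gamma>'"
      using gh by (auto simp: G_def)
    have c: "deck_transformation C p (\<gamma> \<circ> \<gamma>')" using deck_compose \<gamma> by blast
    have "g \<circ> h = hol (\<gamma> \<circ> \<gamma>')"
    proof
      fix x
      have "\<gamma>' (s x) \<in> C" using deck_inverse[OF \<gamma>(3)] sC by metis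
      then show "(g \<circ> h) x = hol (\<gamma> \<circ> \<gamma>') x" using Gs[OF c] Gs[OF \<gamma>(1)] Gs[OF \<gamma>(3)] \<gamma> sdev by simp
    qed
    then show ?thesis using c by (auto simp: G_def)
  qed
  have "\<forall>g\<in>G. \<exists>s'. \<forall>t. g (a + t *\<^sub>R v) = a + (t + s') *\<^sub>R v" using translation by (auto simp: G_def)
  then obtain f where f: "\<And>g t. g \<in> G \<Longrightarrow> g (a + t *\<^sub>R v) = a + (t + f g) *\<^sub>R v" by metis
  have \<pi>inj: "\<exists>r>0. inj_on \<pi> (ball x r)" for x
  proof -
    obtain r \<tau> where r: "r > 0" "sec (ball x r) \<tau>" "inj_on p (\<tau> ` ball x r)"
      using local_section[OF sC[of x]] unfolding devs by metis
    have "\<tau> y = s y" if "y \<in> ball x r" for y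
      using sdev[OF sec_C[OF r(2) that]] sec_dev[OF r(2) that] by simp
    then have "inj_on p (s ` ball x r)" using r(3) by (metis image_cong)
    moreover have "inj_on s (ball x r)" using devs by (rule inj_on_inverseI)
    ultimately show ?thesis using r(1) comp_inj_on unfolding \<pi>_def by blast
  qed
  \<comment> \<open>Infinitely many elements would give points \<open>x n\<close> and
    \<open>g n (x n)\<close> in \<open>K\<close>, converging along a subsequence to
    \<open>x'\<close> and \<open>y'\<close>. These limits are shown to lie in one orbit, and the
    elements of the subsequence to be eventually equal.\<close>
  have Gproper: "finite {g \<in> G. g ` K \<inter> K \<noteq> {}}" if K: "compact K" for K
  proof (rule ccontr)
    assume "infinite {g \<in> G. g ` K \<inter> K \<noteq> {}}"
    then obtain g :: "nat \<Rightarrow> _" where g: "inj g" "range g \<subseteq> {g \<in> G. g ` K \<inter> K \<noteq> {}}"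
      using infinite_countable_subset by blast
    have gG: "g n \<in> G" for n using g by blast
    have "\<forall>n. \<exists>x. x \<in> K \<and> g n x \<in> K" using g(2) by blast
    then obtain x where x: "\<And>n. x n \<in> K" "\<And>n. g n (x n) \<in> K" by metis
    have "\<exists>l\<in>K \<times> K. \<exists>\<phi>::nat \<Rightarrow> nat. strict_mono \<phi> \<and> ((\<lambda>n. (x n, g n (x n))) \<circ> \<phi>) \<longlonglongrightarrow> l"
      by (rule compact_Times[OF K K, unfolded compact_def, rule_format]) (use x in simp)
    then obtain l and \<phi> :: "nat \<Rightarrow> nat" where
      l: "strict_mono \<phi>" "((\<lambda>n. (x n, g n (x n))) \<circ> \<phi>) \<longlonglongrightarrow> l"
      by blast
    define x' y' where "x' = fst l" and "y' = snd l"
    have lx: "(\<lambda>n. x (\<phi> n)) \<longlonglongrightarrow> x'" and ly: "(\<lambda>n. g (\<phi> n) (x (\<phi> n))) \<longlonglongrightarrow> y'"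
      using tendsto_fst[OF l(2)] tendsto_snd[OF l(2)] by (simp_all add: x'_def y'_def)
    \<comment> \<open>Since \<open>M\<close> is Hausdorff, the relation \<pi> x = \<pi> y is closed,
      so it passes to the limit.\<close>
    have "closedin euclidean {z \<in> topspace euclidean. (\<pi> \<circ> fst) z = (\<pi> \<circ> snd) z}"
    proof (rule closedin_continuous_maps_eq[OF Hausdorff_M])
      have "continuous_on UNIV (\<pi> \<circ> fst)" "continuous_on UNIV (\<pi> \<circ> snd)"
        using c\<pi>(1) by (auto simp: o_def intro!: continuous_on_compose2[OF c\<pi>(1)] continuous_intros)
      then show "continuous_map euclidean (top_of_set M) (\<pi> \<circ> fst)" "continuous_map euclidean (top_of_set M) (\<pi> \<circ> snd)"
        using c\<pi>(2) by (auto simp: continuous_map_in_subtopology)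
    qed
    then have cl: "closed {z. (\<pi> \<circ> fst) z = (\<pi> \<circ> snd) z}" by simp
    have mem: "((\<lambda>n. (x n, g n (x n))) \<circ> \<phi>) n \<in> {z. (\<pi> \<circ> fst) z = (\<pi> \<circ> snd) z}" for n
      using \<pi>G[OF gG] by simp
    have "l \<in> {z. (\<pi> \<circ> fst) z = (\<pi> \<circ> snd) z}" by (rule closed_sequentially[OF cl mem l(2)])
    then have "\<pi> x' = \<pi> y'" by (simp add: x'_def y'_def)
    then obtain k where k: "k \<in> G" "k x' = y'" using Gtr by blast
    obtain k' where k': "k' \<in> G" "\<forall>x. k' (k x) = x \<and> k (k' x) = x" using Ginv[OF k(1)] by blast
    obtain r where r: "r > 0" "inj_on \<pi> (ball x' r)" using \<pi>inj by blast
    have "isCont k' y'" using Gcont[OF k'(1)] by (simp add: continuous_on_eq_continuous_at)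
    then have "(\<lambda>n. k' (g (\<phi> n) (x (\<phi> n)))) \<longlonglongrightarrow> k' y'" using ly by (rule isCont_tendsto_compose)
    moreover have "k' y' = x'" using k k' by auto
    ultimately have lk: "(\<lambda>n. k' (g (\<phi> n) (x (\<phi> n)))) \<longlonglongrightarrow> x'" by simp
    have "eventually (\<lambda>n. x (\<phi> n) \<in> ball x' r \<and> k' (g (\<phi> n) (x (\<phi> n))) \<in> ball x' r) sequentially"
      using topological_tendstoD[OF lx, of "ball x' r"] topological_tendstoD[OF lk, of "ball x' r"] r(1)
      by (intro eventually_conj) auto
    then obtain n0 where n0: "\<And>n. n \<ge> n0 \<Longrightarrow> x (\<phi> n) \<in> ball x' r \<and> k' (g (\<phi> n) (x (\<phi> n))) \<in> ball x' r"
      unfolding eventually_sequentially by blast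
    \<comment> \<open>Both \<open>x (\<phi> n)\<close> and its image under
      \<open>g (\<phi> n)\<close> followed by the inverse \<open>k'\<close> of \<open>k\<close> lie
      in a ball where \<pi> is injective and have the same \<pi>-value. They coincide, and freeness
      of the action identifies \<open>g (\<phi> n)\<close> with \<open>k\<close>.\<close>
    have gk: "g (\<phi> n) = k" if "n \<ge> n0" for n
    proof -
      have "\<pi> (k' (g (\<phi> n) (x (\<phi> n)))) = \<pi> (x (\<phi> n))" using \<pi>G[OF k'(1)] \<pi>G[OF gG] by simp
      then have "k' (g (\<phi> n) (x (\<phi> n))) = x (\<phi> n)" using r(2) n0[OF that] unfolding inj_on_def by blast
      then have "g (\<phi> n) (x (\<phi> n)) = k (x (\<phi> n))" using k' by metis
      then show ?thesis using Gfree[OF gG k(1)] by blast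
    qed
    have "g (\<phi> n0) = g (\<phi> (Suc n0))" using gk[of n0] gk[of "Suc n0"] by simp
    then have "\<phi> n0 = \<phi> (Suc n0)" using g(1) by (simp add: inj_eq)
    then show False using l(1) by (simp add: strict_mono_eq)
  qed
  \<comment> \<open>Cocompactness: the images of the balls around \<open>a\<close> form an
    increasing open cover of the compact \<open>M\<close>.\<close>
  obtain R where R: "M \<subseteq> \<pi> ` ball a R"
  proof -
    have op: "openin (top_of_set M) (\<pi> ` ball a (real n))" for n
    proof -
      have "s ` ball a (real n) = C \<inter> dev -` ball a (real n)"
      proof (intro set_eqI iffI)
        show "c \<in> s ` ball a (real n)" if "c \<in> C \<inter> dev -` ball a (real n)" for c
          using that sdev[of c] by (metis IntE image_eqI vimageE)
      qed (use sC devs in auto)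
      moreover have "openin (top_of_set C) (C \<inter> dev -` ball a (real n))"
        using cdev by (intro continuous_openin_preimage_gen) auto
      ultimately show ?thesis using covering_open_map[OF cov] unfolding \<pi>_def image_comp[symmetric] by simp
    qed
    have M: "M \<subseteq> \<Union>(range (\<lambda>n. \<pi> ` ball a (real n)))"
    proof
      fix m assume "m \<in> M"
      then obtain c where c: "c \<in> C" "m = p c" using pC by blast
      obtain n where "dist a (dev c) < real n" using reals_Archimedean2 by blast
      then have "dev c \<in> ball a (real n)" by simp
      moreover have "m = \<pi> (dev c)" using c sdev by (simp add: \<pi>_def)
      ultimately show "m \<in> \<Union>(range (\<lambda>n. \<pi> ` ball a (real n)))" by blast
    qed
    then obtain D where D: "D \<subseteq> range (\<lambda>n. \<pi> ` ball a (real n))" "finite D" "M \<subseteq> \<Union>D"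
      using compact_M[unfolded compact_eq_openin_cover, rule_format, OF conjI[OF _ M]] op by blast
    then obtain I where I: "finite I" "D = (\<lambda>n. \<pi> ` ball a (real n)) ` I" using finite_subset_image by metis
    have "M \<subseteq> \<pi> ` ball a (real (Max (insert 0 I)))"
    proof
      fix m assume "m \<in> M"
      then obtain n where n: "n \<in> I" "m \<in> \<pi> ` ball a (real n)" using D(3) I(2) by blast
      then have "n \<le> Max (insert 0 I)" using I(1) by simp
      then have "ball a (real n) \<subseteq> ball a (real (Max (insert 0 I)))" by (intro subset_ball) simp
      then show "m \<in> \<pi> ` ball a (real (Max (insert 0 I)))" using n(2) by blast
    qed
    then show ?thesis using that by blast
  qed
  have cover: "(\<Union>g\<in>G. g ` ball a R) = UNIV"
  proof -
    have "y \<in> (\<Union>g\<in>G. g ` ball a R)" for y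
    proof -
      obtain x where x: "x \<in> ball a R" "\<pi> y = \<pi> x" using R c\<pi>(2)[of y] by blast
      then obtain g where "g \<in> G" "g x = y" using Gtr[of x y] by auto
      then show ?thesis using x by blast
    qed
    then show ?thesis by blast
  qed
  show False
    by (rule no_cocompact_translation_group[OF dim v_nz Gcont Ginv Gcomp f Gproper cover])
qed

end

theorem theorem4:
  fixes M :: "'m::topological_space set"
    and A :: "('m set \<times> ('m \<Rightarrow> 'a::euclidean_space)) set"
    and C :: "'c::topological_space set"
    and p :: "'c \<Rightarrow> 'm"
    and dev :: "'c \<Rightarrow> 'a"
    and hol :: "('c \<Rightarrow> 'c) \<Rightarrow> ('a \<Rightarrow> 'a)"
    and n :: nat and a v :: 'a
  assumes "n \<ge> 1" and "DIM('a) = n + 1"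
    and "compact M" and "connected M" and "M \<noteq> {}"
    and "Hausdorff_space (top_of_set M)" and "second_countable (top_of_set M)"
    and "affine_atlas M A"
    and "universal_cover C p M"
    and "developing_pair C p A dev hol"
    and "v \<noteq> 0"
    and "\<And>\<gamma>. deck_transformation C p \<gamma> \<Longrightarrow>
           \<exists>s::real. \<forall>t::real. hol \<gamma> (a + t *\<^sub>R v) = a + (t + s) *\<^sub>R v"
  shows "dev ` C \<inter> {a + t *\<^sub>R v | t::real. True} = {}"
proof -
  interpret affine_universal_cover M A C p dev hol a v
    by unfold_locales (use assms in auto)
  show ?thesis using assms(1,2) by (intro dev_avoids_line) simp
qed

end
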